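(* Let $\Omega$ be a finite set, $p_0\in\Delta(\Omega)$ a prior with full support, $A$ a compact set of actions, and $u_S,u_R:A\times\Omega\to\mathbb{R}$ continuous. Let $v:\Delta(\Omega)\to\mathbb{R}$ be the sender's value function $$v(p)=\max_{P\in\mathcal{K}(\Omega):\,p\in P}U_S\big(\hat f_p(P),p\big),$$ and let $\hat v$ be its concave closure, $$\hat v(p)=\inf\{H(p)\mid H:\Delta(\Omega)\to\mathbb{R},\ H\ge v,\ H\text{ affine and continuous}\}.$$ Then the value of optimal ambiguous persuasion at prior $p_0$ is equal to $\hat v(p_0)$.
   Context: For a set $X$, $\Delta(X)$ is the space of probability distributions over $X$ with the weak topology. $\mathcal{K}(\Omega)$ is the set of all (nonempty) closed convex subsets of $\Delta(\Omega)$. For a receiver strategy $f\in\Delta(A)$, a belief $p\in\Delta(\Omega)$ and $i\in\{S,R\}$ (sender, receiver), write $U_i(f,p)=\int_A\sum_{\omega\in\Omega}u_i(a,\omega)p(\omega)\,df(a)$ (equal to $\sum_{a,\omega}f(a)u_i(a,\omega)p(\omega)$ when $f$ has finite support). Receiver's best responses: for $P\in\mathcal{K}(\Omega)$, $\bar f(P)=\arg\max_{f\in\Delta(A)}\min_{p\in P}U_R(f,p)$. For $p\in P$, $\hat f_p(P)\in\bar f(P)$ denotes a sender-preferred element at $p$, i.e. $U_S(\hat f_p(P),p)\ge U_S(f,p)$ for all $f\in\bar f(P)$. Devices: given a finite message space $M$, a probabilistic device is a map $\pi:\Omega\to\Delta(M)$, written $\pi(m|\omega)$; $\tau_\pi(m)=\sum_\omega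 p_0(\omega)\pi(m|\omega)$. An ambiguous device $\Pi$ is a closed and convex (nonempty) set of probabilistic devices on a common finite $M$ with common support: for all $\pi,\pi'\in\Pi$ and $m\in M$, $\tau_\pi(m)>0$ iff $\tau_{\pi'}(m)>0$. For $m$ with $\tau_\pi(m)>0$, the posterior is $p_m^\pi(\omega)=\pi(m|\omega)p_0(\omega)/\tau_\pi(m)$, and $P_m^\Pi=\{p_m^\pi:\pi\in\Pi\}\in\mathcal{K}(\Omega)$ is the receiver's set of posteriors (full Bayesian updating). The value (to the sender, a maxmin expected utility maximizer) of an ambiguous device $\Pi$ is $$\min_{\pi\in\Pi}\ \sum_{m:\tau_\pi(m)>0}\tau_\pi(m)\,U_S\big(\hat f_{p_m^\pi}(P_m^\Pi),p_m^\pi\big).$$ The value of optimal ambiguous persuasion at $p_0$ is the supremum of the values of all ambiguous devices, over all finite message spaces. *)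

theory Defs
  imports "HOL-Probability.Probability"
begin

text \<open>
  States are the elements of a finite type \<open>'w\<close>, so beliefs are vectors in \<open>real ^ 'w\<close>. The weak
  topology on them is the Euclidean one.

  Throughout, \<open>LEAST\<close> and \<open>GREATEST\<close> (rather than \<open>Inf\<close> and \<open>Sup\<close>) render \<open>min\<close> and \<open>max\<close>:
  they are only specified if the minimum or maximum is attained.
\<close>

definition beliefs :: "(real ^ 'w::finite) set" where
  "beliefs = {p. (\<forall>\<omega>. 0 \<le> p $ \<omega>) \<and> (\<Sum>\<omega>\<in>UNIV. p $ \<omega>) = 1}"

definition belief_sets :: "(real ^ 'w::finite) set set" where
  "belief_sets = {P. P \<noteq> {} \<and> P \<subseteq> beliefs \<and> closed P \<and> convex P}"

definition strategies :: "'a::topological_space set \<Rightarrow> 'a measure set" where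
  "strategies A = {f. prob_space f \<and> sets f = sets (restrict_space borel A)}"

definition payoff :: "('a \<Rightarrow> 'w::finite \<Rightarrow> real) \<Rightarrow> 'a measure \<Rightarrow> real ^ 'w \<Rightarrow> real" where
  "payoff u f p = (\<integral>a. (\<Sum>\<omega>\<in>UNIV. u a \<omega> * p $ \<omega>) \<partial>f)"

definition best_responses ::
  "'a::topological_space set \<Rightarrow> ('a \<Rightarrow> 'w::finite \<Rightarrow> real) \<Rightarrow> (real ^ 'w) set \<Rightarrow> 'a measure set" where
  "best_responses A u\<^sub>R P =
     {f. is_arg_max (\<lambda>f. LEAST y. \<exists>p\<in>P. y = payoff u\<^sub>R f p) (\<lambda>f. f \<in> strategies A) f}"

text \<open>A choice of sender-preferred best response; its payoff to the sender at \<open>p\<close> does not depend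
  on the choice.\<close>

definition sender_preferred ::
  "'a::topological_space set \<Rightarrow> ('a \<Rightarrow> 'w::finite \<Rightarrow> real) \<Rightarrow> ('a \<Rightarrow> 'w \<Rightarrow> real) \<Rightarrow>
   real ^ 'w \<Rightarrow> (real ^ 'w) set \<Rightarrow> 'a measure" where
  "sender_preferred A u\<^sub>S u\<^sub>R p P =
     arg_max (\<lambda>f. payoff u\<^sub>S f p) (\<lambda>f. f \<in> best_responses A u\<^sub>R P)"

definition sender_value ::
  "'a::topological_space set \<Rightarrow> ('a \<Rightarrow> 'w::finite \<Rightarrow> real) \<Rightarrow> ('a \<Rightarrow> 'w \<Rightarrow> real) \<Rightarrow>
   real ^ 'w \<Rightarrow> real" where
  "sender_value A u\<^sub>S u\<^sub>R p =
     (GREATEST y. \<exists>P\<in>belief_sets. p \<in> P \<and> y = payoff u\<^sub>S (sender_preferred A u\<^sub>S u\<^sub>R p P) p)"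

definition affine_on_beliefs :: "(real ^ 'w::finite \<Rightarrow> real) \<Rightarrow> bool" where
  "affine_on_beliefs H \<longleftrightarrow>
     (\<forall>p\<in>beliefs. \<forall>q\<in>beliefs. \<forall>t\<in>{0..1}.
        H ((1 - t) *\<^sub>R p + t *\<^sub>R q) = (1 - t) * H p + t * H q)"

definition concave_closure :: "(real ^ 'w::finite \<Rightarrow> real) \<Rightarrow> real ^ 'w \<Rightarrow> real" where
  "concave_closure v p =
     Inf {H p | H. (\<forall>q\<in>beliefs. v q \<le> H q) \<and> affine_on_beliefs H \<and> continuous_on beliefs H}"

text \<open>
  Finite message spaces are taken to be finite sets \<open>M\<close> of natural numbers; up to relabelling these
  are all finite sets. Devices vanish outside \<open>M\<close>, so that the product topology on
  \<open>'w \<Rightarrow> nat \<Rightarrow> real\<close> induces on them the Euclidean topology of the finitely many relevant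
  coordinates. Convexity of a set of devices is spelled out because this function type is not an
  instance of class \<open>real_vector\<close>.
\<close>

definition devices :: "nat set \<Rightarrow> ('w::finite \<Rightarrow> nat \<Rightarrow> real) set" where
  "devices M =
     {\<pi>. \<forall>\<omega>. (\<forall>m. 0 \<le> \<pi> \<omega> m) \<and> (\<forall>m. m \<notin> M \<longrightarrow> \<pi> \<omega> m = 0) \<and> (\<Sum>m\<in>M. \<pi> \<omega> m) = 1}"

definition msg_prob :: "real ^ 'w::finite \<Rightarrow> ('w \<Rightarrow> nat \<Rightarrow> real) \<Rightarrow> nat \<Rightarrow> real" where
  "msg_prob p\<^sub>0 \<pi> m = (\<Sum>\<omega>\<in>UNIV. p\<^sub>0 $ \<omega> * \<pi> \<omega> m)"

definition posterior :: "real ^ 'w::finite \<Rightarrow> ('w \<Rightarrow> nat \<Rightarrow> real) \<Rightarrow> nat \<Rightarrow> real ^ 'w" where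
  "posterior p\<^sub>0 \<pi> m = (\<chi> \<omega>. \<pi> \<omega> m * p\<^sub>0 $ \<omega> / msg_prob p\<^sub>0 \<pi> m)"

definition ambiguous_device ::
  "real ^ 'w::finite \<Rightarrow> nat set \<Rightarrow> ('w \<Rightarrow> nat \<Rightarrow> real) set \<Rightarrow> bool" where
  "ambiguous_device p\<^sub>0 M D \<longleftrightarrow>
     D \<noteq> {} \<and> D \<subseteq> devices M \<and> closed D \<and>
     (\<forall>\<pi>\<in>D. \<forall>\<pi>'\<in>D. \<forall>t\<in>{0..1}. (\<lambda>\<omega> m. (1 - t) * \<pi> \<omega> m + t * \<pi>' \<omega> m) \<in> D) \<and>
     (\<forall>\<pi>\<in>D. \<forall>\<pi>'\<in>D. \<forall>m\<in>M. msg_prob p\<^sub>0 \<pi> m > 0 \<longleftrightarrow> msg_prob p\<^sub>0 \<pi>' m > 0)"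

definition posterior_set ::
  "real ^ 'w::finite \<Rightarrow> ('w \<Rightarrow> nat \<Rightarrow> real) set \<Rightarrow> nat \<Rightarrow> (real ^ 'w) set" where
  "posterior_set p\<^sub>0 D m = (\<lambda>\<pi>. posterior p\<^sub>0 \<pi> m) ` D"

definition device_value ::
  "'a::topological_space set \<Rightarrow> ('a \<Rightarrow> 'w::finite \<Rightarrow> real) \<Rightarrow> ('a \<Rightarrow> 'w \<Rightarrow> real) \<Rightarrow>
   real ^ 'w \<Rightarrow> nat set \<Rightarrow> ('w \<Rightarrow> nat \<Rightarrow> real) set \<Rightarrow> real" where
  "device_value A u\<^sub>S u\<^sub>R p\<^sub>0 M D =
     (LEAST y. \<exists>\<pi>\<in>D. y =
        (\<Sum>m | m \<in> M \<and> msg_prob p\<^sub>0 \<pi> m > 0. msg_prob p\<^sub>0 \<pi> m *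
           payoff u\<^sub>S (sender_preferred A u\<^sub>S u\<^sub>R (posterior p\<^sub>0 \<pi> m) (posterior_set p\<^sub>0 D m))
             (posterior p\<^sub>0 \<pi> m)))"

definition optimal_value ::
  "'a::topological_space set \<Rightarrow> ('a \<Rightarrow> 'w::finite \<Rightarrow> real) \<Rightarrow> ('a \<Rightarrow> 'w \<Rightarrow> real) \<Rightarrow>
   real ^ 'w \<Rightarrow> real" where
  "optimal_value A u\<^sub>S u\<^sub>R p\<^sub>0 =
     Sup {device_value A u\<^sub>S u\<^sub>R p\<^sub>0 M D | M D. finite M \<and> ambiguous_device p\<^sub>0 M D}"

end

(*
  A strategy matters only through its mean vector of utilities, so the strategies reduce to a compact
  convex set of outcomes. By minimax, an outcome c is a best response to some P containing p iff there
  is a belief q such that c is optimal for the receiver at q and yields the receiver at least as much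
  at p as at q; one may then take P to be the segment from p to q. Hence the maximum defining v is
  attained.

  A device is worth at most the expectation of v over the posteriors of any of its members, hence at
  most H(p0) for every affine H above v. Conversely, split p0 into masses alpha_i at p_i and beta_i at
  q_i, where (p_i, q_i) is as above for an outcome c_i. Use two synonymous messages for every i; one
  device sends p_i through the first and q_i through the second, another one exchanges them. On the
  segment joining these two devices each of the messages has the posterior set [p_i, q_i], to which c_i
  is a best response, and the total mass of the pair is constant; so every member guarantees the sender
  the payoff of the outcomes c_i against the whole split. The pairs (belief mass, payoff) obtained in
  this way form a convex cone. If (p0, r) lies outside, a separating hyperplane is the graph of a
  linear function above v whose value at p0 is at most r; it is not vertical because p0 has full
  support.
*)

theory Submission
  imports Defs
begin

subsection \<open>Convexity\<close>

text \<open>Minimax theorem for the inner product, at value 0. If \<open>P\<close> missed the polar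
  cone \<open>N\<close> of \<open>W\<close>, a hyperplane strictly separating the two would have a
  normal \<open>a\<close> that is negative on \<open>P\<close> and nonnegative on \<open>N\<close>.
  Then \<open>- a\<close> lies in the closed cone generated by \<open>W\<close>, so a multiple of a
  single \<open>w\<close> comes close enough to \<open>- a\<close> to be positive on all of
  \<open>P\<close>.\<close>

lemma convex_minimax_nonpos:
  fixes P W :: "'e::euclidean_space set"
  assumes "convex P" "compact P" "P \<noteq> {}" "convex W"
    and W: "\<And>w. w \<in> W \<Longrightarrow> \<exists>p\<in>P. w \<bullet> p \<le> 0"
  shows "\<exists>p\<in>P. \<forall>w\<in>W. w \<bullet> p \<le> 0"
proof (cases "W = {}")
  case False
  show ?thesis
  proof (rule ccontr)
    define N where "N = {p. \<forall>w\<in>W. w \<bullet> p \<le> 0}"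
    have N_eq: "N = (\<Inter>w\<in>W. {p. w \<bullet> p \<le> 0})"
      by (auto simp: N_def)
    assume "\<not> ?thesis"
    then have "P \<inter> N = {}"
      by (auto simp: N_def)
    moreover have "convex N" "closed N"
      unfolding N_eq by (auto intro!: convex_INT closed_INT simp: convex_halfspace_le closed_halfspace_le)
    ultimately obtain a b where P: "\<And>p. p \<in> P \<Longrightarrow> a \<bullet> p < b" and N: "\<And>n. n \<in> N \<Longrightarrow> b < a \<bullet> n"
      using separating_hyperplane_compact_closed[of P N] assms by metis
    have b: "b < 0"
      using N[of 0] by (simp add: N_def)
    have N0: "0 \<le> a \<bullet> n" if n: "n \<in> N" for n
    proof (rule ccontr)
      assume neg: "\<not> 0 \<le> a \<bullet> n"
      \<comment> \<open>\<open>N\<close> is a cone, and this multiple of \<open>n\<close> has inner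
        product exactly \<open>b\<close> with \<open>a\<close>, against the strict
        separation.\<close>
      have "(b / (a \<bullet> n)) *\<^sub>R n \<in> N"
        using n neg b unfolding N_def
        by (auto simp only: inner_scaleR_right mem_Collect_eq intro!: mult_nonneg_nonpos divide_nonpos_nonpos)
      from N[OF this] neg show False
        by simp
    qed
    define K where "K = closure (cone hull W)"
    have K: "convex K" "closed K" "cone K"
      using \<open>convex W\<close> by (auto simp: K_def convex_cone_hull convex_closure cone_cone_hull cone_closure)
    have "0 \<in> K"
      using K False by (metis cone_0 K_def closure_eq_empty cone_hull_empty_iff cone_contains_0)
    have WK: "W \<subseteq> K"
      using closure_subset hull_subset unfolding K_def by (metis subset_trans)
    \<comment> \<open>\<open>- a\<close> is positive on \<open>P\<close> and, by the bipolar theorem, a limit of multiples of members of \<open>W\<close>.\<close>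
    have "- a \<in> K"
    proof (rule ccontr)
      assume "- a \<notin> K"
      then obtain n c where n: "n \<bullet> (- a) < c" and nK: "\<And>k. k \<in> K \<Longrightarrow> c < n \<bullet> k"
        using separating_hyperplane_closed_point[of K "- a"] K by blast
      have c: "c < 0"
        using nK[OF \<open>0 \<in> K\<close>] by simp
      have "0 \<le> n \<bullet> k" if k: "k \<in> K" for k
      proof (rule ccontr)
        assume neg: "\<not> 0 \<le> n \<bullet> k"
        have "(c / (n \<bullet> k)) *\<^sub>R k \<in> K"
          using K(3) k neg c by (intro mem_cone) (auto simp: divide_nonpos_nonpos)
        from nK[OF this] neg show False
          by simp
      qed
      then have "- n \<in> N"
        using WK by (auto simp: N_def inner_commute)
      from N0[OF this] n c show False
        by (simp add: inner_commute)
    qed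
    obtain B where B: "0 < B" "\<And>p. p \<in> P \<Longrightarrow> norm p \<le> B"
      using compact_imp_bounded[OF \<open>compact P\<close>] by (auto simp: bounded_pos)
    \<comment> \<open>On \<open>P\<close> the functional of \<open>- a\<close> exceeds
      \<open>- b\<close>. Since \<open>B\<close> bounds the norms in \<open>P\<close>, an error
      below \<open>- b / B\<close> changes its values there by at most \<open>- b\<close>.\<close>
    obtain d where d: "d \<in> cone hull W" "dist d (- a) < - b / B"
      using \<open>- a \<in> K\<close> b B(1) unfolding K_def closure_approachable
      by (metis divide_pos_pos neg_0_less_iff_less)
    then obtain l w where l: "0 \<le> l" "w \<in> W" "d = l *\<^sub>R w"
      by (auto simp: cone_hull_expl)
    obtain p where p: "p \<in> P" "w \<bullet> p \<le> 0"
      using W l by blast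
    have "- a \<bullet> p = (- a - d) \<bullet> p + l * (w \<bullet> p)"
      by (simp add: l inner_diff_left)
    also have "\<dots> \<le> norm (- a - d) * norm p + 0"
      using l p by (intro add_mono norm_cauchy_schwarz) (auto simp: mult_nonneg_nonpos)
    also have "\<dots> \<le> (- b / B) * B"
      unfolding add_0_right using d(2) B p(1) b
      by (intro mult_mono) (auto simp: dist_norm norm_minus_commute add.commute divide_nonpos_pos less_imp_le)
    finally show False
      using P[OF p(1)] B(1) by simp
  qed
qed (use assms in auto)

section \<open>Means of probability measures and convex hulls\<close>

lemma (in prob_space) expectation_in_closed_convex:
  fixes g :: "'a \<Rightarrow> 'e::euclidean_space"
  assumes "integrable M g" "closed S" "convex S" and S: "\<And>x. x \<in> space M \<Longrightarrow> g x \<in> S"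
  shows "expectation g \<in> S"
proof (rule ccontr)
  assume "expectation g \<notin> S"
  then obtain a b where ab: "a \<bullet> expectation g < b" "\<And>x. x \<in> S \<Longrightarrow> b < a \<bullet> x"
    using separating_hyperplane_closed_point[of S "expectation g"] assms by blast
  have "b \<le> expectation (\<lambda>x. a \<bullet> g x)"
    using assms(1) ab(2) S by (intro integral_ge_const) (auto intro!: AE_I2 less_imp_le)
  then show False
    using ab(1) assms(1) by simp
qed

text \<open>In finite dimension the convex hull of the compact image is itself compact, hence
  closed, so a mean cannot be separated from it and no closure has to be taken.\<close>

lemma expectation_in_convex_hull:
  fixes g :: "'a::topological_space \<Rightarrow> 'e::euclidean_space"
  assumes "compact A" "continuous_on A g" "f \<in> strategies A"
  shows "integrable f g" "integral\<^sup>L f g \<in> convex hull (g ` A)"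
proof -
  interpret prob_space f
    using assms by (simp add: strategies_def)
  have sets: "sets f = sets (restrict_space borel A)"
    using assms by (simp add: strategies_def)
  have space: "space f = A"
    using sets_eq_imp_space_eq[OF sets] by (simp add: space_restrict_space)
  have cpt: "compact (g ` A)"
    using assms by (intro compact_continuous_image)
  then obtain B where "\<And>a. a \<in> A \<Longrightarrow> norm (g a) \<le> B"
    using compact_imp_bounded by (fastforce simp: bounded_iff)
  then show int: "integrable f g"
    using borel_measurable_continuous_on_restrict[OF assms(2)]
    by (intro integrable_const_bound[of _ B]) (auto simp: space measurable_cong_sets[OF sets refl])
  show "integral\<^sup>L f g \<in> convex hull (g ` A)"
    using cpt by (intro expectation_in_closed_convex int)
      (auto simp: space hull_inc compact_convex_hull compact_imp_closed)
qed

text \<open>Finitely supported strategies suffice: the weights of a convex combination become point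
  masses at chosen preimages.\<close>

lemma convex_hull_expectation:
  fixes g :: "'a::topological_space \<Rightarrow> 'e::euclidean_space"
  assumes "continuous_on A g" "y \<in> convex hull (g ` A)"
  shows "\<exists>f\<in>strategies A. integral\<^sup>L f g = y"
proof -
  obtain k :: nat and u x where u: "\<forall>i\<in>{1..k}. 0 \<le> u i \<and> x i \<in> g ` A" "sum u {1..k} = 1"
    and y: "(\<Sum>i = 1..k. u i *\<^sub>R x i) = y"
    using assms(2) unfolding convex_hull_indexed by blast
  have "\<forall>i\<in>{1..k}. \<exists>a\<in>A. x i = g a"
    using u(1) by blast
  then obtain a where a: "\<And>i. i \<in> {1..k} \<Longrightarrow> a i \<in> A \<and> x i = g (a i)"
    by metis
  \<comment> \<open>\<open>N\<close> lives on the indices because different ones may select the same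
    action; the push-forward along \<open>a\<close> adds up their weights.\<close>
  define N where "N = point_measure {1..k} (\<lambda>i. ennreal (u i))"
  have meas: "a \<in> measurable N (restrict_space borel A)"
    using a by (auto simp: N_def space_restrict_space)
  have "(\<Sum>i = 1..k. ennreal (u i)) = 1"
    using u by (subst sum_ennreal) auto
  then have "prob_space (distr N (restrict_space borel A) a)"
    using u meas unfolding N_def by (intro prob_space.prob_space_distr prob_space_point_measure) auto
  moreover have "integral\<^sup>L (distr N (restrict_space borel A) a) g = integral\<^sup>L N (\<lambda>i. g (a i))"
    by (intro integral_distr meas borel_measurable_continuous_on_restrict assms)
  moreover have "\<dots> = (\<Sum>i = 1..k. u i *\<^sub>R g (a i))"
    unfolding N_def using u by (intro lebesgue_integral_point_measure_finite) auto
  moreover have "\<dots> = y"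
    using a y by (metis (no_types, lifting) sum.cong)
  ultimately show ?thesis
    by (intro bexI[of _ "distr N (restrict_space borel A) a"]) (auto simp: strategies_def)
qed

subsection \<open>Sets of beliefs\<close>

lemma mem_beliefs_nonneg: "p \<in> beliefs \<Longrightarrow> 0 \<le> p $ \<omega>"
  by (simp add: beliefs_def)

lemma norm_belief_le_1: "p \<in> beliefs \<Longrightarrow> norm p \<le> 1"
  using norm_le_l1_cart[of p] by (simp add: beliefs_def)

lemma convex_beliefs: "convex beliefs"
  by (auto simp: convex_def beliefs_def sum.distrib simp flip: sum_distrib_left)

lemma compact_beliefs: "compact (beliefs :: (real ^ 'w::finite) set)"
proof -
  have "beliefs = (\<Inter>\<omega>. {p. 0 \<le> p $ \<omega>}) \<inter> {p :: real ^ 'w. (\<Sum>\<omega>\<in>UNIV. p $ \<omega>) = 1}"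
    by (auto simp: beliefs_def)
  moreover have "closed ((\<Inter>\<omega>. {p. 0 \<le> p $ \<omega>}) \<inter> {p :: real ^ 'w. (\<Sum>\<omega>\<in>UNIV. p $ \<omega>) = 1})"
    by (intro closed_Int closed_INT closed_Collect_le closed_Collect_eq ballI continuous_intros)
  moreover have "bounded (beliefs :: (real ^ 'w) set)"
    using norm_belief_le_1 by (auto simp: bounded_iff)
  ultimately show ?thesis
    by (simp add: compact_eq_bounded_closed)
qed

lemma belief_setsD:
  assumes "P \<in> belief_sets"
  shows "compact P" "convex P" "P \<noteq> {}" "P \<subseteq> beliefs"
  using assms compact_Int_closed[OF compact_beliefs, of P]
  by (auto simp: belief_sets_def Int_absorb1)

lemma closed_segment_belief_sets:
  assumes "p \<in> beliefs" "q \<in> beliefs"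
  shows "closed_segment p q \<in> belief_sets"
  using assms closed_segment_subset[OF _ _ convex_beliefs] by (auto simp: belief_sets_def)

text \<open>Minus the support function of \<open>P\<close> at \<open>- y\<close>: the worst-case
  payoff of a strategy with mean utility vector \<open>y\<close>.\<close>

definition guarantee :: "(real ^ 'w::finite) set \<Rightarrow> real ^ 'w \<Rightarrow> real" where
  "guarantee P y = Inf ((\<lambda>p. y \<bullet> p) ` P)"

lemma
  assumes P: "P \<in> belief_sets"
  shows guarantee_attained: "\<exists>p\<in>P. guarantee P y = y \<bullet> p"
    and guarantee_le: "p \<in> P \<Longrightarrow> guarantee P y \<le> y \<bullet> p"
proof -
  have "compact ((\<lambda>p. y \<bullet> p) ` P)"
    using belief_setsD[OF P] by (intro compact_continuous_image continuous_intros)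
  then have "\<exists>m\<in>P. \<forall>p\<in>P. y \<bullet> m \<le> y \<bullet> p"
    using compact_attains_inf[of "(\<lambda>p. y \<bullet> p) ` P"] belief_setsD[OF P] by auto
  then obtain m where m: "m \<in> P" "\<And>p. p \<in> P \<Longrightarrow> y \<bullet> m \<le> y \<bullet> p"
    by blast
  then have "guarantee P y = y \<bullet> m"
    unfolding guarantee_def by (intro cInf_eq_minimum) auto
  then show "\<exists>p\<in>P. guarantee P y = y \<bullet> p" "p \<in> P \<Longrightarrow> guarantee P y \<le> y \<bullet> p"
    using m by auto
qed

lemma guarantee_eqI:
  assumes "P \<in> belief_sets" "p \<in> P" "\<And>p'. p' \<in> P \<Longrightarrow> y \<bullet> p \<le> y \<bullet> p'"
  shows "guarantee P y = y \<bullet> p"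
  using guarantee_attained[OF assms(1), of y] guarantee_le[OF assms(1,2), of y] assms(3)
  by (metis order_antisym)

lemma continuous_on_guarantee:
  assumes P: "P \<in> belief_sets"
  shows "continuous_on S (guarantee P)"
proof -
  have *: "guarantee P y - guarantee P z \<le> norm (y - z)" for y z
  proof -
    obtain p where p: "p \<in> P" "guarantee P z = z \<bullet> p"
      using guarantee_attained[OF P] by blast
    have "(y - z) \<bullet> p \<le> norm (y - z) * norm p"
      by (rule norm_cauchy_schwarz)
    also have "\<dots> \<le> norm (y - z)"
      using norm_belief_le_1[of p] belief_setsD(4)[OF P] p(1) by (simp add: mult_left_le subset_iff)
    finally show ?thesis
      using guarantee_le[OF P p(1), of y] p(2) by (simp add: inner_diff_left)
  qed
  have "1-lipschitz_on S (guarantee P)"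
  proof (rule lipschitz_onI)
    fix y z show "dist (guarantee P y) (guarantee P z) \<le> 1 * dist y z"
      using *[of y z] *[of z y] by (simp add: dist_norm abs_le_iff norm_minus_commute)
  qed simp
  then show ?thesis
    by (rule lipschitz_on_continuous_on)
qed

subsection \<open>Best responses\<close>

locale persuasion =
  fixes A :: "'a::topological_space set" and u\<^sub>S u\<^sub>R :: "'a \<Rightarrow> 'w::finite \<Rightarrow> real"
  assumes compact_A: "compact A" and A_nonempty: "A \<noteq> {}"
    and continuous_u\<^sub>S: "\<And>\<omega>. continuous_on A (\<lambda>a. u\<^sub>S a \<omega>)"
    and continuous_u\<^sub>R: "\<And>\<omega>. continuous_on A (\<lambda>a. u\<^sub>R a \<omega>)"
begin

section \<open>Reduction of strategies to outcomes\<close>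

definition utility :: "'a \<Rightarrow> (real ^ 'w) \<times> (real ^ 'w)" where
  "utility a = (\<chi> \<omega>. u\<^sub>S a \<omega>, \<chi> \<omega>. u\<^sub>R a \<omega>)"

definition outcome :: "'a measure \<Rightarrow> (real ^ 'w) \<times> (real ^ 'w)" where
  "outcome f = integral\<^sup>L f utility"

definition outcomes :: "((real ^ 'w) \<times> (real ^ 'w)) set" where
  "outcomes = convex hull (utility ` A)"

lemma continuous_utility: "continuous_on A utility"
  unfolding utility_def using continuous_u\<^sub>S continuous_u\<^sub>R
  by (intro continuous_intros)

lemma outcomes_nonempty: "outcomes \<noteq> {}"
  using A_nonempty by (simp add: outcomes_def)

lemma convex_outcomes: "convex outcomes"
  by (simp add: outcomes_def)

lemma compact_outcomes: "compact outcomes"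
  unfolding outcomes_def
  by (intro compact_convex_hull compact_continuous_image continuous_utility compact_A)

lemma outcome_strategies: "outcome ` strategies A = outcomes"
proof (intro set_eqI iffI)
  fix c assume "c \<in> outcome ` strategies A"
  then show "c \<in> outcomes"
    using expectation_in_convex_hull(2)[OF compact_A continuous_utility]
    by (auto simp only: outcome_def outcomes_def)
next
  fix c assume "c \<in> outcomes"
  then show "c \<in> outcome ` strategies A"
    using convex_hull_expectation[OF continuous_utility]
    unfolding outcome_def outcomes_def image_iff by metis
qed

lemma
  assumes "f \<in> strategies A"
  shows payoff_sender: "payoff u\<^sub>S f p = fst (outcome f) \<bullet> p"
    and payoff_receiver: "payoff u\<^sub>R f p = snd (outcome f) \<bullet> p"
proof -
  note int = expectation_in_convex_hull(1)[OF compact_A continuous_utility assms]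
  have "bounded_linear (\<lambda>c. fst c \<bullet> p)" "bounded_linear (\<lambda>c. snd c \<bullet> p)" for p :: "real ^ 'w"
    by (auto intro: bounded_linear_compose[OF bounded_linear_inner_left]
        bounded_linear_fst bounded_linear_snd)
  from this[THEN integral_bounded_linear, OF int] 
  show "payoff u\<^sub>S f p = fst (outcome f) \<bullet> p" "payoff u\<^sub>R f p = snd (outcome f) \<bullet> p"
    by (simp_all add: payoff_def outcome_def utility_def inner_vec_def)
qed

definition best :: "(real ^ 'w) set \<Rightarrow> ((real ^ 'w) \<times> (real ^ 'w)) set" where
  "best P = {c \<in> outcomes. \<forall>d\<in>outcomes. guarantee P (snd d) \<le> guarantee P (snd c)}"

lemma mem_best_responses_iff:
  assumes P: "P \<in> belief_sets"
  shows "f \<in> best_responses A u\<^sub>R P \<longleftrightarrow> f \<in> strategies A \<and> outcome f \<in> best P"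
proof -
  have "(LEAST y. \<exists>p\<in>P. y = payoff u\<^sub>R f p) = guarantee P (snd (outcome f))" if f: "f \<in> strategies A" for f
    using guarantee_attained[OF P] guarantee_le[OF P]
    by (intro Least_equality) (auto simp: payoff_receiver[OF f])
  then show ?thesis
    using outcome_strategies
    by (auto simp: best_responses_def is_arg_max_def best_def not_less simp flip: outcome_strategies)
qed

lemma
  assumes P: "P \<in> belief_sets"
  shows best_nonempty: "best P \<noteq> {}" and compact_best: "compact (best P)"
proof -
  have cont: "continuous_on outcomes (\<lambda>c. guarantee P (snd c))"
    by (rule continuous_on_compose2[OF continuous_on_guarantee[OF P, of UNIV]])
       (auto intro: continuous_intros)
  then show "best P \<noteq> {}"
    using continuous_attains_sup[OF compact_outcomes outcomes_nonempty cont]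
    unfolding best_def by blast
  then obtain c where c: "c \<in> best P"
    by blast
  \<comment> \<open>Comparison with one maximiser replaces the comparison with all outcomes, leaving
    a superlevel set of a continuous function.\<close>
  then have "best P = {d \<in> outcomes. guarantee P (snd c) \<le> guarantee P (snd d)}"
    by (auto simp: best_def intro: order_trans)
  moreover have "closed {d \<in> outcomes. guarantee P (snd c) \<le> guarantee P (snd d)}"
    by (intro continuous_on_closed_Collect_le cont continuous_on_const
        compact_imp_closed compact_outcomes)
  ultimately have "closed (best P)"
    by simp
  moreover have "best P = outcomes \<inter> best P"
    by (auto simp: best_def)
  ultimately show "compact (best P)"
    using compact_Int_closed[OF compact_outcomes, of "best P"] by simp
qed

definition sender_payoff :: "(real ^ 'w) set \<Rightarrow> real ^ 'w \<Rightarrow> real" where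
  "sender_payoff P p = payoff u\<^sub>S (sender_preferred A u\<^sub>S u\<^sub>R p P) p"

text \<open>Compactness of \<open>best P\<close> provides a maximiser, so the choice made by
  \<open>arg_max\<close> really returns one.\<close>

lemma
  assumes P: "P \<in> belief_sets"
  shows sender_payoff_attained: "\<exists>c\<in>best P. sender_payoff P p = fst c \<bullet> p"
    and sender_payoff_ge: "c \<in> best P \<Longrightarrow> fst c \<bullet> p \<le> sender_payoff P p"
proof -
  have "continuous_on (best P) (\<lambda>c. fst c \<bullet> p)"
    by (intro continuous_intros)
  then obtain c where c: "c \<in> best P" "\<And>d. d \<in> best P \<Longrightarrow> fst d \<bullet> p \<le> fst c \<bullet> p"
    using continuous_attains_sup[OF compact_best[OF P] best_nonempty[OF P]] by blast
  moreover have "c \<in> outcomes"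
    using c(1) by (simp add: best_def)
  then obtain f where "f \<in> strategies A" "outcome f = c"
    unfolding outcome_strategies[symmetric] by (metis imageE)
  ultimately have "is_arg_max (\<lambda>f. payoff u\<^sub>S f p) (\<lambda>f. f \<in> best_responses A u\<^sub>R P) f"
    by (auto simp: is_arg_max_def mem_best_responses_iff[OF P] payoff_sender not_less)
  then have *: "is_arg_max (\<lambda>f. payoff u\<^sub>S f p) (\<lambda>f. f \<in> best_responses A u\<^sub>R P)
      (sender_preferred A u\<^sub>S u\<^sub>R p P)"
    unfolding sender_preferred_def arg_max_def by (rule someI)
  then show "\<exists>c\<in>best P. sender_payoff P p = fst c \<bullet> p"
    by (auto simp: is_arg_max_def mem_best_responses_iff[OF P] payoff_sender sender_payoff_def)
  fix c assume c: "c \<in> best P"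
  then have "c \<in> outcomes"
    by (simp add: best_def)
  then obtain f where "f \<in> strategies A" "outcome f = c"
    unfolding outcome_strategies[symmetric] by (metis imageE)
  then show "fst c \<bullet> p \<le> sender_payoff P p"
    using * c by (auto simp: is_arg_max_def mem_best_responses_iff[OF P] payoff_sender
        sender_payoff_def not_less)
qed

text \<open>By minimax, \<open>c\<close> is a best response to some set of beliefs containing \<open>p\<close> iff it is one to the
  segment from \<open>p\<close> to a belief \<open>q\<close> as below. Unlike the space of all such sets, the pairs
  \<open>(c, q)\<close> range over a compact subset of a Euclidean space.\<close>

definition supported :: "real ^ 'w \<Rightarrow> ((real ^ 'w) \<times> (real ^ 'w)) \<Rightarrow> real ^ 'w \<Rightarrow> bool" where
  "supported p c q \<longleftrightarrow> c \<in> outcomes \<and> q \<in> beliefs \<and>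
     (\<forall>d\<in>outcomes. snd d \<bullet> q \<le> snd c \<bullet> q) \<and> snd c \<bullet> q \<le> snd c \<bullet> p"

text \<open>Let \<open>g\<close> be the receiver's maximal guarantee. Each outcome is held down to
  \<open>g\<close> by some belief in \<open>P\<close>; by minimax a single \<open>q\<close> does so
  for all outcomes. As \<open>c\<close> yields at least \<open>g\<close> throughout
  \<open>P\<close>, it yields exactly \<open>g\<close> at \<open>q\<close>, which is optimal there,
  and at least \<open>g\<close> at \<open>p\<close>.\<close>

lemma best_imp_supported:
  assumes P: "P \<in> belief_sets" and c: "c \<in> best P" and p: "p \<in> P"
  shows "\<exists>q\<in>P. supported p c q"
proof -
  define g where "g = guarantee P (snd c)"
  \<comment> \<open>Beliefs sum to 1, so subtracting the constant vector \<open>g\<close> lowers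
    every payoff by \<open>g\<close> and brings the game to value 0.\<close>
  define W where "W = (\<lambda>d. snd d - (\<chi> \<omega>. g)) ` outcomes"
  have W_inner: "(y - (\<chi> \<omega>. g)) \<bullet> q = y \<bullet> q - g" if "q \<in> P" for y q
  proof -
    have "(\<chi> \<omega>. g) \<bullet> q = g * (\<Sum>\<omega>\<in>UNIV. q $ \<omega>)"
      by (simp add: inner_vec_def sum_distrib_left)
    then show ?thesis
      using that belief_setsD(4)[OF P] by (auto simp: inner_diff_left beliefs_def)
  qed
  have "W = (\<lambda>y. - (\<chi> \<omega>. g) + y) ` snd ` outcomes"
    by (auto simp: W_def image_image)
  then have "convex W"
    using convex_outcomes by (simp add: convex_translation_eq convex_linear_image linear_snd)
  moreover have "\<exists>q\<in>P. w \<bullet> q \<le> 0" if "w \<in> W" for w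
  proof -
    have "\<exists>d\<in>outcomes. w = snd d - (\<chi> \<omega>. g)"
      using that by (simp only: W_def image_iff)
    then obtain d where d: "d \<in> outcomes" "w = snd d - (\<chi> \<omega>. g)"
      by (elim bexE)
    then have "guarantee P (snd d) \<le> g"
      using c by (simp add: best_def g_def)
    then show ?thesis
      using guarantee_attained[OF P, of "snd d"] W_inner d(2) by auto
  qed
  ultimately obtain q where q: "q \<in> P" "\<And>w. w \<in> W \<Longrightarrow> w \<bullet> q \<le> 0"
    using convex_minimax_nonpos[of P W] belief_setsD[OF P] by blast
  have le: "snd d \<bullet> q \<le> g" if "d \<in> outcomes" for d
    using q(2)[of "snd d - (\<chi> \<omega>. g)"] that by (simp add: W_def W_inner[OF q(1)])
  have cO: "c \<in> outcomes"
    using c by (simp add: best_def)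
  have "snd c \<bullet> q = g" "g \<le> snd c \<bullet> p"
    using le[OF cO] guarantee_le[OF P] q(1) p by (auto simp: g_def intro: order_antisym)
  then show ?thesis
    using q(1) le cO belief_setsD(4)[OF P] by (auto simp: supported_def)
qed

text \<open>Along the segment the receiver's payoff from \<open>c\<close> is affine and smallest at
  \<open>q\<close>. Any other outcome guarantees at most its payoff at \<open>q\<close>, where
  \<open>c\<close> is optimal.\<close>

lemma supported_imp_best:
  assumes p: "p \<in> beliefs" and c: "supported p c q"
  shows "c \<in> best (closed_segment p q)"
proof -
  have P: "closed_segment p q \<in> belief_sets"
    using c p by (auto simp: supported_def intro: closed_segment_belief_sets)
  have "guarantee (closed_segment p q) (snd c) = snd c \<bullet> q"
  proof (rule guarantee_eqI[OF P])
    fix r assume "r \<in> closed_segment p q"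
    then obtain t where t: "0 \<le> t" "t \<le> 1" "r = (1 - t) *\<^sub>R p + t *\<^sub>R q"
      by (auto simp: closed_segment_def)
    have "(1 - t) * (snd c \<bullet> q) \<le> (1 - t) * (snd c \<bullet> p)"
      using t c by (intro mult_left_mono) (auto simp: supported_def)
    then show "snd c \<bullet> q \<le> snd c \<bullet> r"
      by (simp add: t inner_add_right algebra_simps)
  qed simp
  moreover have "guarantee (closed_segment p q) (snd d) \<le> snd d \<bullet> q" for d :: "(real ^ 'w) \<times> (real ^ 'w)"
    by (intro guarantee_le[OF P]) simp
  ultimately show ?thesis
    using c by (fastforce simp: best_def supported_def intro: order_trans)
qed

text \<open>For the singleton \<open>{p}\<close> the belief returned by minimax can only be
  \<open>p\<close> itself.\<close>

lemma ex_supported: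
  assumes "p \<in> beliefs"
  shows "\<exists>c. supported p c p"
proof -
  have P: "{p} \<in> belief_sets"
    using assms by (simp add: belief_sets_def)
  obtain c where c: "c \<in> best {p}"
    using best_nonempty[OF P] by blast
  from best_imp_supported[OF P c] show ?thesis
    by (metis singletonD singletonI)
qed

section \<open>The sender's value function as an attained maximum\<close>

lemma ex_max_supported:
  assumes p: "p \<in> beliefs"
  shows "\<exists>c q. supported p c q \<and> (\<forall>d r. supported p d r \<longrightarrow> fst d \<bullet> p \<le> fst c \<bullet> p)"
proof -
  define T where "T = {x. supported p (fst x) (snd x)}"
  \<comment> \<open>Only weak inequalities between continuous functions of the pair occur, so
    \<open>T\<close> is closed in a compact product.\<close>
  have T: "T = (outcomes \<times> beliefs) \<inter>
      ((\<Inter>d\<in>outcomes. {x. snd d \<bullet> snd x \<le> snd (fst x) \<bullet> snd x}) \<inter>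
       {x. snd (fst x) \<bullet> snd x \<le> snd (fst x) \<bullet> p})"
    by (rule set_eqI) (simp add: T_def supported_def mem_Times_iff conj_assoc del: split_paired_All)
  have "compact T"
    unfolding T
    by (intro compact_Int_closed compact_Times compact_outcomes compact_beliefs closed_Int
        closed_INT ballI closed_Collect_le continuous_intros)
  moreover have "T \<noteq> {}"
  proof -
    obtain c where "supported p c p"
      using ex_supported[OF p] by (elim exE)
    then have "(c, p) \<in> T"
      by (simp add: T_def)
    then show ?thesis
      by (metis empty_iff)
  qed
  moreover have "continuous_on T (\<lambda>x. fst (fst x) \<bullet> p)"
    by (intro continuous_intros)
  ultimately obtain x where "x \<in> T" "\<forall>y\<in>T. fst (fst y) \<bullet> p \<le> fst (fst x) \<bullet> p"
    using continuous_attains_sup by blast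
  then have "supported p (fst x) (snd x)"
    and "supported p d r \<Longrightarrow> fst d \<bullet> p \<le> fst (fst x) \<bullet> p" for d r
    by (simp_all add: T_def del: split_paired_All) (metis fst_conv snd_conv)
  then show ?thesis
    by (intro exI[of _ "fst x"] exI[of _ "snd x"] conjI allI impI)
qed

text \<open>The best pair \<open>(c, q)\<close> is realised by the segment from \<open>p\<close> to
  \<open>q\<close>; no other set does better, since its best responses are supported by beliefs of
  their own.\<close>

lemma
  assumes p: "p \<in> beliefs"
  shows sender_value_attained: "\<exists>c q. supported p c q \<and> sender_value A u\<^sub>S u\<^sub>R p = fst c \<bullet> p"
    and sender_value_ge: "P \<in> belief_sets \<Longrightarrow> p \<in> P \<Longrightarrow> sender_payoff P p \<le> sender_value A u\<^sub>S u\<^sub>R p"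
proof -
  obtain c q where c: "supported p c q"
    and max: "\<And>d r. supported p d r \<Longrightarrow> fst d \<bullet> p \<le> fst c \<bullet> p"
    using ex_max_supported[OF p] by blast
  have le: "sender_payoff P p \<le> fst c \<bullet> p" if P: "P \<in> belief_sets" "p \<in> P" for P
    using sender_payoff_attained[OF P(1), of p] best_imp_supported[OF P(1) _ P(2)] max by fastforce
  have P: "closed_segment p q \<in> belief_sets"
    using c p by (auto simp: supported_def intro: closed_segment_belief_sets)
  have "sender_payoff (closed_segment p q) p = fst c \<bullet> p"
    using le[OF P] sender_payoff_ge[OF P supported_imp_best[OF p c]] by (auto intro: order_antisym)
  then have eq: "sender_value A u\<^sub>S u\<^sub>R p = fst c \<bullet> p"
    unfolding sender_value_def sender_payoff_def[symmetric] using P le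
    by (intro Greatest_equality bexI[OF _ P]) auto
  show "\<exists>c q. supported p c q \<and> sender_value A u\<^sub>S u\<^sub>R p = fst c \<bullet> p"
    using c eq by metis
  show "P \<in> belief_sets \<Longrightarrow> p \<in> P \<Longrightarrow> sender_payoff P p \<le> sender_value A u\<^sub>S u\<^sub>R p"
    using le eq by simp
qed

end

subsection \<open>Devices\<close>

text \<open>Tychonoff's theorem for the function-space topology.\<close>

lemma compact_Pi_UNIV:
  fixes S :: "'i \<Rightarrow> 'b::topological_space set"
  assumes "\<And>i. compact (S i)"
  shows "compact {f. \<forall>i. f i \<in> S i}"
proof -
  have "compactin (product_topology (\<lambda>i. euclidean) UNIV) (PiE UNIV S)"
    using assms by (simp add: compactin_PiE)
  moreover have "PiE UNIV S = {f. \<forall>i. f i \<in> S i}"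
    by auto
  ultimately show ?thesis
    by (simp add: euclidean_product_topology)
qed

text \<open>Tychonoff is applied twice, over states and over messages; coordinates outside
  \<open>M\<close> are pinned to 0.\<close>

lemma compact_device_set:
  assumes "closed D" "D \<subseteq> devices M" "finite M"
  shows "compact D"
proof -
  let ?K = "{\<pi>. \<forall>\<omega>. \<pi> \<omega> \<in> {g. \<forall>m. g m \<in> (if m \<in> M then {0..1::real} else {0})}}"
  have "compact ?K"
    by (intro compact_Pi_UNIV) simp
  moreover have "D \<subseteq> ?K"
  proof
    fix \<pi> assume "\<pi> \<in> D"
    then have "\<pi> \<in> devices M"
      using assms by blast
    then have \<pi>: "0 \<le> \<pi> \<omega> m" "m \<notin> M \<Longrightarrow> \<pi> \<omega> m = 0" "(\<Sum>m\<in>M. \<pi> \<omega> m) = 1" for \<omega> m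
      by (simp_all add: devices_def)
    have "\<pi> \<omega> m \<le> 1" if "m \<in> M" for \<omega> m
      using member_le_sum[OF that, of "\<pi> \<omega>"] \<pi> \<open>finite M\<close> by auto
    then show "\<pi> \<in> ?K"
      using \<pi> by auto
  qed
  ultimately show ?thesis
    using compact_Int_closed[of ?K D] \<open>closed D\<close> by (simp add: Int_absorb1)
qed

lemma continuous_on_device_eval: "continuous_on D (\<lambda>\<pi>. \<pi> \<omega> m :: real)"
  using continuous_on_id[of D, THEN continuous_on_product_then_coordinatewise, of \<omega>]
  by (rule continuous_on_product_then_coordinatewise)

lemma continuous_on_msg_prob: "continuous_on D (\<lambda>\<pi>. msg_prob p\<^sub>0 \<pi> m)"
  unfolding msg_prob_def by (intro continuous_intros continuous_on_device_eval)

lemma continuous_on_posterior: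
  assumes "\<And>\<pi>. \<pi> \<in> D \<Longrightarrow> msg_prob p\<^sub>0 \<pi> m \<noteq> 0"
  shows "continuous_on D (\<lambda>\<pi>. posterior p\<^sub>0 \<pi> m)"
  unfolding posterior_def
  using assms
  by (intro continuous_intros continuous_on_device_eval continuous_on_msg_prob) blast

lemma msg_prob_nonneg:
  assumes "p\<^sub>0 \<in> beliefs" "\<pi> \<in> devices M"
  shows "0 \<le> msg_prob p\<^sub>0 \<pi> m"
  using assms by (auto simp: msg_prob_def beliefs_def devices_def intro!: sum_nonneg)

lemma posterior_in_beliefs:
  assumes "p\<^sub>0 \<in> beliefs" "\<pi> \<in> devices M" "0 < msg_prob p\<^sub>0 \<pi> m"
  shows "posterior p\<^sub>0 \<pi> m \<in> beliefs"
proof -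
  have "(\<Sum>\<omega>\<in>UNIV. posterior p\<^sub>0 \<pi> m $ \<omega>) = (\<Sum>\<omega>\<in>UNIV. \<pi> \<omega> m * p\<^sub>0 $ \<omega>) / msg_prob p\<^sub>0 \<pi> m"
    by (simp add: posterior_def sum_divide_distrib)
  also have "(\<Sum>\<omega>\<in>UNIV. \<pi> \<omega> m * p\<^sub>0 $ \<omega>) = msg_prob p\<^sub>0 \<pi> m"
    by (simp add: msg_prob_def mult.commute)
  finally show ?thesis
    using assms by (auto simp: beliefs_def devices_def posterior_def)
qed

text \<open>Conditioning on a message is a projective map: it carries segments to segments, with
  changed weights. This makes posterior sets convex.\<close>

lemma posterior_mixture:
  assumes a: "0 < msg_prob p\<^sub>0 \<pi> m" and b: "0 < msg_prob p\<^sub>0 \<pi>' m" and t: "t \<in> {0..1}"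
  shows "\<exists>s\<in>{0..1}. posterior p\<^sub>0 (\<lambda>\<omega> m. (1 - s) * \<pi> \<omega> m + s * \<pi>' \<omega> m) m =
    (1 - t) *\<^sub>R posterior p\<^sub>0 \<pi> m + t *\<^sub>R posterior p\<^sub>0 \<pi>' m"
proof -
  define x y where "x = msg_prob p\<^sub>0 \<pi> m" and "y = msg_prob p\<^sub>0 \<pi>' m"
  \<comment> \<open>In a mixture with weight \<open>s\<close> the two posteriors have masses
    \<open>(1 - s) * x\<close> and \<open>s * y\<close>. For these to be proportional to
    \<open>1 - t\<close> and \<open>t\<close>, \<open>s\<close> must be proportional to
    \<open>t / y\<close> and \<open>1 - s\<close> to \<open>(1 - t) / x\<close>; \<open>k\<close>
    normalises.\<close>
  define k where "k = (1 - t) / x + t / y"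
  define s where "s = t / y / k"
  have pos: "0 < x" "0 < y"
    using a b by (simp_all add: x_def y_def)
  have k: "0 < k"
  proof (cases "t = 0")
    case False
    then have "0 \<le> (1 - t) / x" "0 < t / y"
      using pos t by simp_all
    then show ?thesis
      unfolding k_def by (rule add_nonneg_pos)
  qed (use pos in \<open>simp add: k_def\<close>)
  have s': "1 - s = (1 - t) / x / k"
  proof -
    have "1 - s = (k - t / y) / k"
      using k by (simp add: s_def diff_divide_distrib)
    then show ?thesis
      by (simp add: k_def)
  qed
  have s: "s \<in> {0..1}"
  proof -
    have "0 \<le> s"
      using t pos k by (simp add: s_def)
    moreover have "0 \<le> 1 - s"
      unfolding s' using t pos k by simp
    ultimately show ?thesis
      by simp
  qed
  have "msg_prob p\<^sub>0 (\<lambda>\<omega> m. (1 - s) * \<pi> \<omega> m + s * \<pi>' \<omega> m) m = (1 - s) * x + s * y"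
    unfolding msg_prob_def x_def y_def sum_distrib_left sum.distrib[symmetric]
    by (intro sum.cong refl) (simp add: algebra_simps)
  also have "\<dots> = 1 / k"
    unfolding s' using pos k by (simp add: s_def flip: add_divide_distrib)
  finally have "posterior p\<^sub>0 (\<lambda>\<omega> m. (1 - s) * \<pi> \<omega> m + s * \<pi>' \<omega> m) m $ \<omega> =
      k * (1 - s) * (\<pi> \<omega> m * p\<^sub>0 $ \<omega>) + k * s * (\<pi>' \<omega> m * p\<^sub>0 $ \<omega>)" for \<omega>
    by (simp add: posterior_def algebra_simps)
  moreover have "k * (1 - s) = (1 - t) / x" "k * s = t / y"
    unfolding s' using k by (simp_all add: s_def)
  ultimately have "posterior p\<^sub>0 (\<lambda>\<omega> m. (1 - s) * \<pi> \<omega> m + s * \<pi>' \<omega> m) m =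
      (1 - t) *\<^sub>R posterior p\<^sub>0 \<pi> m + t *\<^sub>R posterior p\<^sub>0 \<pi>' m"
    by (simp add: vec_eq_iff posterior_def x_def y_def)
  then show ?thesis
    using s by blast
qed

lemma posterior_set_in_belief_sets:
  assumes p: "p\<^sub>0 \<in> beliefs" and D: "ambiguous_device p\<^sub>0 M D" "finite M"
    and pos: "\<And>\<pi>. \<pi> \<in> D \<Longrightarrow> 0 < msg_prob p\<^sub>0 \<pi> m"
  shows "posterior_set p\<^sub>0 D m \<in> belief_sets"
proof -
  have "compact D" "\<And>\<pi>. \<pi> \<in> D \<Longrightarrow> msg_prob p\<^sub>0 \<pi> m \<noteq> 0"
    using D compact_device_set[of D M] pos by (auto simp: ambiguous_device_def) (metis less_irrefl)
  then have "compact (posterior_set p\<^sub>0 D m)"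
    unfolding posterior_set_def by (intro compact_continuous_image continuous_on_posterior)
  moreover have "posterior_set p\<^sub>0 D m \<subseteq> beliefs" "posterior_set p\<^sub>0 D m \<noteq> {}"
    using D p pos by (auto simp: posterior_set_def ambiguous_device_def intro!: posterior_in_beliefs)
  moreover have "convex (posterior_set p\<^sub>0 D m)"
    unfolding convex_alt posterior_set_def
  proof (clarify)
    fix \<pi> \<pi>' and t :: real assume \<pi>: "\<pi> \<in> D" "\<pi>' \<in> D" and t: "0 \<le> t" "t \<le> 1"
    obtain s where s: "s \<in> {0..1}" "posterior p\<^sub>0 (\<lambda>\<omega> m. (1 - s) * \<pi> \<omega> m + s * \<pi>' \<omega> m) m =
        (1 - t) *\<^sub>R posterior p\<^sub>0 \<pi> m + t *\<^sub>R posterior p\<^sub>0 \<pi>' m"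
      using posterior_mixture[OF pos[OF \<pi>(1)] pos[OF \<pi>(2)], of t] t by auto
    have "(\<lambda>\<omega> m. (1 - s) * \<pi> \<omega> m + s * \<pi>' \<omega> m) \<in> D"
      using D(1) \<pi> s(1) by (auto simp: ambiguous_device_def)
    then show "(1 - t) *\<^sub>R posterior p\<^sub>0 \<pi> m + t *\<^sub>R posterior p\<^sub>0 \<pi>' m \<in> (\<lambda>\<pi>. posterior p\<^sub>0 \<pi> m) ` D"
      unfolding s(2)[symmetric] by (rule imageI)
  qed
  ultimately show ?thesis
    by (simp add: belief_sets_def compact_imp_closed)
qed

section \<open>Bayes plausibility and averages of affine functions\<close>

lemma sum_msg_prob:
  assumes "p\<^sub>0 \<in> beliefs" "\<pi> \<in> devices M"
  shows "(\<Sum>m\<in>M. msg_prob p\<^sub>0 \<pi> m) = 1"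
proof -
  have "(\<Sum>m\<in>M. msg_prob p\<^sub>0 \<pi> m) = (\<Sum>\<omega>\<in>UNIV. p\<^sub>0 $ \<omega> * (\<Sum>m\<in>M. \<pi> \<omega> m))"
    unfolding msg_prob_def sum_distrib_left by (rule sum.swap)
  then show ?thesis
    using assms by (simp add: devices_def beliefs_def)
qed

lemma msg_prob_posterior:
  assumes "0 < msg_prob p\<^sub>0 \<pi> m"
  shows "msg_prob p\<^sub>0 \<pi> m *\<^sub>R posterior p\<^sub>0 \<pi> m = (\<chi> \<omega>. \<pi> \<omega> m * p\<^sub>0 $ \<omega>)"
  using assms by (simp add: vec_eq_iff posterior_def)

lemma msg_prob_eq_0_D:
  assumes "p\<^sub>0 \<in> beliefs" "\<pi> \<in> devices M" "\<not> 0 < msg_prob p\<^sub>0 \<pi> m"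
  shows "\<pi> \<omega> m * p\<^sub>0 $ \<omega> = 0"
proof -
  have "msg_prob p\<^sub>0 \<pi> m = 0"
    using msg_prob_nonneg[OF assms(1,2)] assms(3) by (metis order_le_less)
  then show ?thesis
    using assms by (simp add: msg_prob_def sum_nonneg_eq_0_iff devices_def beliefs_def mult.commute)
qed

lemma sum_msg_prob_posterior:
  assumes "finite M" "p\<^sub>0 \<in> beliefs" "\<pi> \<in> devices M"
  shows "(\<Sum>m | m \<in> M \<and> 0 < msg_prob p\<^sub>0 \<pi> m. msg_prob p\<^sub>0 \<pi> m *\<^sub>R posterior p\<^sub>0 \<pi> m) = p\<^sub>0"
    and "(\<Sum>m | m \<in> M \<and> 0 < msg_prob p\<^sub>0 \<pi> m. msg_prob p\<^sub>0 \<pi> m) = 1"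
proof -
  have "(\<Sum>m | m \<in> M \<and> 0 < msg_prob p\<^sub>0 \<pi> m. msg_prob p\<^sub>0 \<pi> m *\<^sub>R posterior p\<^sub>0 \<pi> m) =
      (\<Sum>m | m \<in> M \<and> 0 < msg_prob p\<^sub>0 \<pi> m. \<chi> \<omega>. \<pi> \<omega> m * p\<^sub>0 $ \<omega>)"
    by (intro sum.cong refl msg_prob_posterior) simp
  \<comment> \<open>Messages of probability 0 can be added back: their joint mass with every state
    vanishes.\<close>
  also have "\<dots> = (\<Sum>m\<in>M. \<chi> \<omega>. \<pi> \<omega> m * p\<^sub>0 $ \<omega>)"
    using msg_prob_eq_0_D[OF assms(2,3)] assms(1)
    by (intro sum.mono_neutral_left) (auto simp: vec_eq_iff)
  also have "\<dots> = p\<^sub>0"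
    using assms(3) by (simp add: vec_eq_iff devices_def flip: sum_distrib_right)
  finally show "(\<Sum>m | m \<in> M \<and> 0 < msg_prob p\<^sub>0 \<pi> m. msg_prob p\<^sub>0 \<pi> m *\<^sub>R posterior p\<^sub>0 \<pi> m) = p\<^sub>0" .
  have "(\<Sum>m | m \<in> M \<and> 0 < msg_prob p\<^sub>0 \<pi> m. msg_prob p\<^sub>0 \<pi> m) = (\<Sum>m\<in>M. msg_prob p\<^sub>0 \<pi> m)"
    using msg_prob_nonneg[OF assms(2,3)] assms(1)
    by (intro sum.mono_neutral_left) (auto simp: order_less_le)
  then show "(\<Sum>m | m \<in> M \<and> 0 < msg_prob p\<^sub>0 \<pi> m. msg_prob p\<^sub>0 \<pi> m) = 1"
    using sum_msg_prob[OF assms(2,3)] by simp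
qed

text \<open>Jensen's inequality for both \<open>H\<close> and \<open>- H\<close>.\<close>

lemma affine_on_beliefs_sum:
  assumes "affine_on_beliefs H" "finite I" "(\<Sum>i\<in>I. a i) = 1"
    and "\<And>i. i \<in> I \<Longrightarrow> 0 \<le> a i" "\<And>i. i \<in> I \<Longrightarrow> p i \<in> beliefs"
  shows "(\<Sum>i\<in>I. a i * H (p i)) = H (\<Sum>i\<in>I. a i *\<^sub>R p i)"
proof -
  have "convex_on beliefs H" "convex_on beliefs (\<lambda>p. - H p)"
    using assms(1) by (auto simp: affine_on_beliefs_def convex_beliefs intro!: convex_onI)
  moreover have "I \<noteq> {}"
    using assms(3) by auto
  moreover have "h (\<Sum>i\<in>I. a i *\<^sub>R p i) \<le> (\<Sum>i\<in>I. a i * h (p i))"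
    if "convex_on beliefs h" "I \<noteq> {}" for h
    by (rule convex_on_sum[OF assms(2) that(2,1) assms(3-5)])
  ultimately have "H (\<Sum>i\<in>I. a i *\<^sub>R p i) \<le> (\<Sum>i\<in>I. a i * H (p i))"
    "- H (\<Sum>i\<in>I. a i *\<^sub>R p i) \<le> (\<Sum>i\<in>I. a i * (- H (p i)))"
    by blast+
  then show ?thesis
    by (simp add: sum_negf)
qed

section \<open>The value of a device and its upper bound\<close>

context persuasion
begin

lemma outcomes_bounded: "\<exists>B>0. \<forall>c\<in>outcomes. norm (fst c) \<le> B"
proof -
  obtain B where "0 < B" "\<And>c. c \<in> outcomes \<Longrightarrow> norm c \<le> B"
    using compact_imp_bounded[OF compact_outcomes] unfolding bounded_pos by metis
  moreover have "norm (fst c) \<le> norm c" for c :: "(real ^ 'w) \<times> (real ^ 'w)"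
    using norm_fst_le[of "fst c" "snd c"] by simp
  ultimately have "\<forall>c\<in>outcomes. norm (fst c) \<le> B"
    by (blast intro: order_trans)
  then show ?thesis
    using \<open>0 < B\<close> by blast
qed

text \<open>As a function of \<open>p\<close> this is a maximum of linear functionals with
  coefficients bounded by \<open>B\<close>, hence \<open>B\<close>-Lipschitz.\<close>

lemma continuous_on_sender_payoff:
  assumes P: "P \<in> belief_sets"
  shows "continuous_on S (sender_payoff P)"
proof -
  obtain B where B: "0 < B" "\<And>c. c \<in> outcomes \<Longrightarrow> norm (fst c) \<le> B"
    using outcomes_bounded by blast
  have *: "sender_payoff P p - sender_payoff P r \<le> B * norm (p - r)" for p r
  proof -
    obtain c where c: "c \<in> best P" "sender_payoff P p = fst c \<bullet> p"
      using sender_payoff_attained[OF P] by blast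
    have "fst c \<bullet> (p - r) \<le> norm (fst c) * norm (p - r)"
      by (rule norm_cauchy_schwarz)
    also have "\<dots> \<le> B * norm (p - r)"
      using B(2)[of c] c(1) by (intro mult_right_mono) (simp_all add: best_def)
    finally show ?thesis
      using sender_payoff_ge[OF P c(1), of r] c(2) by (simp add: inner_diff_right)
  qed
  have "B-lipschitz_on S (sender_payoff P)"
  proof (rule lipschitz_onI)
    fix p r show "dist (sender_payoff P p) (sender_payoff P r) \<le> B * dist p r"
      using *[of p r] *[of r p] by (simp add: dist_norm abs_le_iff norm_minus_commute)
  qed (use B in simp)
  then show ?thesis
    by (rule lipschitz_on_continuous_on)
qed

definition device_payoff :: "real ^ 'w \<Rightarrow> nat set \<Rightarrow> ('w \<Rightarrow> nat \<Rightarrow> real) set \<Rightarrow> ('w \<Rightarrow> nat \<Rightarrow> real) \<Rightarrow> real"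
  where "device_payoff p\<^sub>0 M D \<pi> = (\<Sum>m | m \<in> M \<and> 0 < msg_prob p\<^sub>0 \<pi> m.
    msg_prob p\<^sub>0 \<pi> m * sender_payoff (posterior_set p\<^sub>0 D m) (posterior p\<^sub>0 \<pi> m))"

lemma
  assumes p: "p\<^sub>0 \<in> beliefs" and D: "ambiguous_device p\<^sub>0 M D" and M: "finite M"
  shows device_value_attained: "\<exists>\<pi>\<in>D. device_value A u\<^sub>S u\<^sub>R p\<^sub>0 M D = device_payoff p\<^sub>0 M D \<pi>"
    and device_value_le: "\<pi> \<in> D \<Longrightarrow> device_value A u\<^sub>S u\<^sub>R p\<^sub>0 M D \<le> device_payoff p\<^sub>0 M D \<pi>"
proof -
  obtain \<pi>\<^sub>0 where \<pi>\<^sub>0: "\<pi>\<^sub>0 \<in> D"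
    using D by (auto simp: ambiguous_device_def)
  define N where "N = {m \<in> M. 0 < msg_prob p\<^sub>0 \<pi>\<^sub>0 m}"
  \<comment> \<open>Common support: all members of \<open>D\<close> send the same messages with
    positive probability, so the payoff is a continuous sum over a fixed index set and attains its
    minimum on the compact \<open>D\<close>.\<close>
  have N: "{m. m \<in> M \<and> 0 < msg_prob p\<^sub>0 \<pi> m} = N" if "\<pi> \<in> D" for \<pi>
    using that \<pi>\<^sub>0 D unfolding N_def ambiguous_device_def by blast
  have pos: "0 < msg_prob p\<^sub>0 \<pi> m" if "\<pi> \<in> D" "m \<in> N" for \<pi> m
    using N[OF that(1)] that(2) by blast
  have "continuous_on D (\<lambda>\<pi>. \<Sum>m\<in>N.
      msg_prob p\<^sub>0 \<pi> m * sender_payoff (posterior_set p\<^sub>0 D m) (posterior p\<^sub>0 \<pi> m))"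
  proof (intro continuous_on_sum continuous_on_mult continuous_on_msg_prob)
    fix m assume "m \<in> N"
    then have pos': "0 < msg_prob p\<^sub>0 \<pi> m" if "\<pi> \<in> D" for \<pi>
      using pos that by blast
    then have "msg_prob p\<^sub>0 \<pi> m \<noteq> 0" if "\<pi> \<in> D" for \<pi>
      using that by (metis less_irrefl)
    then show "continuous_on D (\<lambda>\<pi>. sender_payoff (posterior_set p\<^sub>0 D m) (posterior p\<^sub>0 \<pi> m))"
      by (intro continuous_on_compose2[OF continuous_on_sender_payoff continuous_on_posterior subset_UNIV]
          posterior_set_in_belief_sets[OF p D M] pos')
  qed
  then have "continuous_on D (device_payoff p\<^sub>0 M D)"
    by (rule continuous_on_eq) (simp add: device_payoff_def N)
  moreover have "compact D" "D \<noteq> {}"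
    using D M compact_device_set by (auto simp: ambiguous_device_def)
  ultimately obtain \<pi>\<^sub>1 where \<pi>\<^sub>1: "\<pi>\<^sub>1 \<in> D" "\<And>\<pi>. \<pi> \<in> D \<Longrightarrow> device_payoff p\<^sub>0 M D \<pi>\<^sub>1 \<le> device_payoff p\<^sub>0 M D \<pi>"
    using continuous_attains_inf by metis
  have eq: "device_value A u\<^sub>S u\<^sub>R p\<^sub>0 M D = device_payoff p\<^sub>0 M D \<pi>\<^sub>1"
    unfolding device_value_def sender_payoff_def[symmetric] device_payoff_def[symmetric]
    using \<pi>\<^sub>1 by (intro Least_equality) auto
  show "\<exists>\<pi>\<in>D. device_value A u\<^sub>S u\<^sub>R p\<^sub>0 M D = device_payoff p\<^sub>0 M D \<pi>"
    using eq \<pi>\<^sub>1(1) by blast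
  show "\<pi> \<in> D \<Longrightarrow> device_value A u\<^sub>S u\<^sub>R p\<^sub>0 M D \<le> device_payoff p\<^sub>0 M D \<pi>"
    using eq \<pi>\<^sub>1(2) by simp
qed

lemma device_value_le_affine:
  assumes p: "p\<^sub>0 \<in> beliefs" and D: "ambiguous_device p\<^sub>0 M D" and M: "finite M"
    and H: "affine_on_beliefs H" "\<And>q. q \<in> beliefs \<Longrightarrow> sender_value A u\<^sub>S u\<^sub>R q \<le> H q"
  shows "device_value A u\<^sub>S u\<^sub>R p\<^sub>0 M D \<le> H p\<^sub>0"
proof -
  obtain \<pi> where \<pi>: "\<pi> \<in> D"
    using D by (auto simp: ambiguous_device_def)
  then have \<pi>M: "\<pi> \<in> devices M"
    using D by (auto simp: ambiguous_device_def)
  let ?N = "{m. m \<in> M \<and> 0 < msg_prob p\<^sub>0 \<pi> m}"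
  have "device_value A u\<^sub>S u\<^sub>R p\<^sub>0 M D \<le> device_payoff p\<^sub>0 M D \<pi>"
    by (rule device_value_le[OF p D M \<pi>])
  also have "\<dots> \<le> (\<Sum>m\<in>?N. msg_prob p\<^sub>0 \<pi> m * H (posterior p\<^sub>0 \<pi> m))"
    unfolding device_payoff_def
  proof (intro sum_mono mult_left_mono)
    fix m assume m: "m \<in> ?N"
    then have pos: "0 < msg_prob p\<^sub>0 \<pi>' m" if "\<pi>' \<in> D" for \<pi>'
      using D \<pi> that unfolding ambiguous_device_def by blast
    have "posterior p\<^sub>0 \<pi> m \<in> beliefs"
      using m by (intro posterior_in_beliefs[OF p \<pi>M]) simp
    \<comment> \<open>The realised posterior set thus competes in the maximum that defines the
      sender's value at this posterior.\<close>
    moreover have "posterior p\<^sub>0 \<pi> m \<in> posterior_set p\<^sub>0 D m"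
      using \<pi> by (simp add: posterior_set_def)
    ultimately show "sender_payoff (posterior_set p\<^sub>0 D m) (posterior p\<^sub>0 \<pi> m) \<le> H (posterior p\<^sub>0 \<pi> m)"
      using sender_value_ge posterior_set_in_belief_sets[OF p D M pos] H(2) by (meson order_trans)
  qed simp
  also have "\<dots> = H p\<^sub>0"
    using sum_msg_prob_posterior[OF M p \<pi>M] posterior_in_beliefs[OF p \<pi>M] M
    by (subst affine_on_beliefs_sum[OF H(1)]) auto
  finally show ?thesis .
qed

end

subsection \<open>Hedging with synonyms\<close>

lemma sum_lessThan_double:
  fixes g :: "nat \<Rightarrow> 'b::comm_monoid_add"
  shows "(\<Sum>m<2 * k. g m) = (\<Sum>i<k. g (2 * i) + g (2 * i + 1))"
  by (induction k) (simp_all add: add.assoc)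

context persuasion
begin

text \<open>Supplies a constant majorant, so that the infimum in the concave closure runs over a
  nonempty set.\<close>

lemma sender_value_bounded: "\<exists>B. \<forall>p\<in>beliefs. sender_value A u\<^sub>S u\<^sub>R p \<le> B"
proof -
  obtain B where B: "0 < B" "\<And>c. c \<in> outcomes \<Longrightarrow> norm (fst c) \<le> B"
    using outcomes_bounded by blast
  have "sender_value A u\<^sub>S u\<^sub>R p \<le> B" if p: "p \<in> beliefs" for p
  proof -
    obtain c q where c: "supported p c q" "sender_value A u\<^sub>S u\<^sub>R p = fst c \<bullet> p"
      using sender_value_attained[OF p] by (elim exE conjE)
    have "fst c \<bullet> p \<le> norm (fst c) * norm p"
      by (rule norm_cauchy_schwarz)
    also have "\<dots> \<le> B * 1"
      using B c(1) norm_belief_le_1[OF p] by (intro mult_mono) (auto simp: supported_def)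
    finally show ?thesis
      by (simp add: c(2))
  qed
  then show ?thesis
    by blast
qed

text \<open>Answering both synonyms of a pair with \<open>c i\<close> earns the sender the same
  total under every member of \<open>D\<close>. Strict positivity of \<alpha> and \<beta> keeps each
  message possible throughout, as common support demands.\<close>

lemma ex_hedged_device:
  fixes k :: nat and p q :: "nat \<Rightarrow> real ^ 'w" and \<alpha> \<beta> :: "nat \<Rightarrow> real"
  assumes p\<^sub>0: "p\<^sub>0 \<in> beliefs" "\<And>\<omega>. 0 < p\<^sub>0 $ \<omega>"
    and p: "\<And>i. i < k \<Longrightarrow> p i \<in> beliefs"
    and c: "\<And>i. i < k \<Longrightarrow> supported (p i) (c i) (q i)"
    and pos: "\<And>i. i < k \<Longrightarrow> 0 < \<alpha> i" "\<And>i. i < k \<Longrightarrow> 0 < \<beta> i"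
    and split: "(\<Sum>i<k. \<alpha> i *\<^sub>R p i + \<beta> i *\<^sub>R q i) = p\<^sub>0"
  shows "\<exists>M D. finite M \<and> ambiguous_device p\<^sub>0 M D \<and>
    (\<Sum>i<k. fst (c i) \<bullet> (\<alpha> i *\<^sub>R p i + \<beta> i *\<^sub>R q i)) \<le> device_value A u\<^sub>S u\<^sub>R p\<^sub>0 M D"
proof -
  have q: "q i \<in> beliefs" if "i < k" for i
    using c[OF that] by (simp add: supported_def)
  define M :: "nat set" where "M = {..<2 * k}"
  \<comment> \<open>\<open>s t m\<close> is the weight of the \<open>p\<close> role in message
    \<open>m\<close>, \<open>z t m\<close> the joint mass of \<open>m\<close> with the states, and
    \<open>w t m\<close> its total.\<close>
  define s :: "real \<Rightarrow> nat \<Rightarrow> real" where "s t m = (if even m then t else 1 - t)" for t m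
  define z :: "real \<Rightarrow> nat \<Rightarrow> real ^ 'w" where
    "z t m = (s t m * \<alpha> (m div 2)) *\<^sub>R p (m div 2) + ((1 - s t m) * \<beta> (m div 2)) *\<^sub>R q (m div 2)" for t m
  define w where "w t m = s t m * \<alpha> (m div 2) + (1 - s t m) * \<beta> (m div 2)" for t m
  \<comment> \<open>Messages \<open>2 * i\<close> and \<open>2 * i + 1\<close> are synonyms: at \<open>t = 1\<close> the former carries \<open>p i\<close> with mass
    \<open>\<alpha> i\<close> and the latter \<open>q i\<close> with mass \<open>\<beta> i\<close>, at \<open>t = 0\<close> the roles are exchanged, and the total
    mass of the pair does not depend on \<open>t\<close>.\<close>
  define \<pi> :: "real \<Rightarrow> 'w \<Rightarrow> nat \<Rightarrow> real" where
    "\<pi> t \<omega> m = (if m \<in> M then z t m $ \<omega> / p\<^sub>0 $ \<omega> else 0)" for t \<omega> m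
  define D where "D = \<pi> ` {0..1}"
  have div2: "m div 2 < k" if "m \<in> M" for m
    using that by (auto simp: M_def)
  have s: "s t m \<in> {0..1}" if "t \<in> {0..1}" for t m
    using that by (auto simp: s_def)
  have z_nonneg: "0 \<le> z t m $ \<omega>" if "t \<in> {0..1}" "m \<in> M" for t m \<omega>
    using s[OF that(1), of m] div2[OF that(2)] pos p q
    by (auto simp: z_def less_imp_le intro!: add_nonneg_nonneg mult_nonneg_nonneg mem_beliefs_nonneg)
  have z_pair: "z t (2 * i) + z t (2 * i + 1) = \<alpha> i *\<^sub>R p i + \<beta> i *\<^sub>R q i" for t i
    by (simp add: z_def s_def algebra_simps)
  have w_pos: "0 < w t m" if t: "t \<in> {0..1}" and m: "m \<in> M" for t m
  proof (cases "s t m = 0")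
    case False
    then have "0 < s t m * \<alpha> (m div 2)" "0 \<le> (1 - s t m) * \<beta> (m div 2)"
      using s[OF t, of m] pos[OF div2[OF m]] by simp_all
    then show ?thesis
      unfolding w_def by (rule add_pos_nonneg)
  qed (use pos[OF div2[OF m]] in \<open>simp add: w_def\<close>)
  have sum_z: "(\<Sum>\<omega>\<in>UNIV. z t m $ \<omega>) = w t m" if "m \<in> M" for t m
    using p[OF div2[OF that]] q[OF div2[OF that]]
    by (simp add: z_def w_def sum.distrib beliefs_def flip: sum_distrib_left)
  have \<pi>_devices: "\<pi> t \<in> devices M" if t: "t \<in> {0..1}" for t
  proof -
    have "(\<Sum>m\<in>M. \<pi> t \<omega> m) = 1" for \<omega>
    proof -
      have "(\<Sum>m\<in>M. \<pi> t \<omega> m) = (\<Sum>m<2 * k. z t m) $ \<omega> / p\<^sub>0 $ \<omega>"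
        by (simp add: \<pi>_def M_def sum_divide_distrib)
      also have "(\<Sum>m<2 * k. z t m) = p\<^sub>0"
        unfolding sum_lessThan_double z_pair by (rule split)
      finally show ?thesis
        using p\<^sub>0(2)[of \<omega>] by simp
    qed
    then show ?thesis
      using z_nonneg[OF t] p\<^sub>0(2) by (simp add: devices_def \<pi>_def less_imp_le)
  qed
  have \<pi>_p\<^sub>0: "\<pi> t \<omega> m * p\<^sub>0 $ \<omega> = z t m $ \<omega>" if "m \<in> M" for t \<omega> m
    using p\<^sub>0(2)[of \<omega>] that by (simp add: \<pi>_def)
  have msg_prob: "msg_prob p\<^sub>0 (\<pi> t) m = w t m" if "m \<in> M" for t m
    unfolding msg_prob_def using sum_z[OF that] \<pi>_p\<^sub>0[OF that] by (simp add: mult.commute)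
  have posterior: "posterior p\<^sub>0 (\<pi> t) m = (1 / w t m) *\<^sub>R z t m" if "m \<in> M" for t m
    by (simp add: vec_eq_iff posterior_def msg_prob[OF that] \<pi>_p\<^sub>0[OF that])
  \<comment> \<open>\<open>z\<close> is affine in \<open>t\<close>, which makes \<open>D\<close> a
    segment of devices.\<close>
  have mix: "(\<lambda>\<omega> m. (1 - r) * \<pi> t \<omega> m + r * \<pi> t' \<omega> m) = \<pi> ((1 - r) * t + r * t')" for r t t'
  proof (intro ext)
    fix \<omega> m
    have "(1 - r) * z t m $ \<omega> + r * z t' m $ \<omega> = z ((1 - r) * t + r * t') m $ \<omega>"
      by (simp add: z_def s_def algebra_simps)
    then show "(1 - r) * \<pi> t \<omega> m + r * \<pi> t' \<omega> m = \<pi> ((1 - r) * t + r * t') \<omega> m"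
      by (simp add: \<pi>_def flip: add_divide_distrib)
  qed
  have closed: "closed D"
  proof -
    have "continuous_on {0..1} \<pi>"
    proof (intro continuous_on_coordinatewise_then_product)
      fix \<omega> m
      show "continuous_on {0..1} (\<lambda>t. \<pi> t \<omega> m)"
        unfolding \<pi>_def z_def s_def using p\<^sub>0(2)[of \<omega>]
        by (cases "m \<in> M"; cases "even m") (auto intro!: continuous_intros)
    qed
    then show ?thesis
      unfolding D_def by (intro compact_imp_closed compact_continuous_image) auto
  qed
  have D: "ambiguous_device p\<^sub>0 M D"
    unfolding ambiguous_device_def
  proof (intro conjI ballI)
    fix \<rho> \<rho>' and r :: real assume \<rho>: "\<rho> \<in> D" "\<rho>' \<in> D" and r: "r \<in> {0..1}"
    then obtain t t' where t: "t \<in> {0..1}" "\<rho> = \<pi> t" "t' \<in> {0..1}" "\<rho>' = \<pi> t'"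
      by (auto simp: D_def)
    have "(1 - r) * t + r * t' \<in> {0..1}"
      using convexD_alt[OF convex_real_interval(5) t(1,3), of r] r by simp
    then show "(\<lambda>\<omega> m. (1 - r) * \<rho> \<omega> m + r * \<rho>' \<omega> m) \<in> D"
      unfolding t(2,4) mix D_def by (rule imageI)
  qed (use closed \<pi>_devices in \<open>auto simp: D_def msg_prob w_pos\<close>)
  have finite: "finite M"
    by (simp add: M_def)
  have posterior_set: "posterior_set p\<^sub>0 D m = closed_segment (p (m div 2)) (q (m div 2))" if m: "m \<in> M" for m
  proof
    show "posterior_set p\<^sub>0 D m \<subseteq> closed_segment (p (m div 2)) (q (m div 2))"
    proof
      fix x assume "x \<in> posterior_set p\<^sub>0 D m"
      then obtain t where t: "t \<in> {0..1}" and x: "x = (1 / w t m) *\<^sub>R z t m"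
        by (auto simp: posterior_set_def D_def posterior[OF m])
      \<comment> \<open>The share of the mass of message \<open>m\<close> that stems from
        \<open>q\<close>.\<close>
      define r where "r = (1 - s t m) * \<beta> (m div 2) / w t m"
      have r': "1 - r = s t m * \<alpha> (m div 2) / w t m"
      proof -
        have "1 - r = (w t m - (1 - s t m) * \<beta> (m div 2)) / w t m"
          using w_pos[OF t m] by (simp add: r_def diff_divide_distrib)
        then show ?thesis
          by (simp add: w_def)
      qed
      have "0 \<le> r"
        using s[OF t, of m] pos[OF div2[OF m]] w_pos[OF t m] by (simp add: r_def)
      moreover have "0 \<le> 1 - r"
        unfolding r' using s[OF t, of m] pos[OF div2[OF m]] w_pos[OF t m] by simp
      moreover have "x = (1 - r) *\<^sub>R p (m div 2) + r *\<^sub>R q (m div 2)"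
        unfolding r' x by (simp add: z_def r_def scaleR_add_right divide_inverse mult.commute)
      ultimately show "x \<in> closed_segment (p (m div 2)) (q (m div 2))"
        unfolding closed_segment_def by auto
    qed
    have P: "posterior_set p\<^sub>0 D m \<in> belief_sets"
      using m by (intro posterior_set_in_belief_sets[OF p\<^sub>0(1) D finite])
        (auto simp: D_def msg_prob w_pos)
    \<comment> \<open>At the two extreme devices a message reveals \<open>p\<close> or
      \<open>q\<close> exactly, according to its parity; convexity of the posterior set fills in the
      segment.\<close>
    have ends: "posterior p\<^sub>0 (\<pi> (if even m then 1 else 0)) m = p (m div 2)"
      "posterior p\<^sub>0 (\<pi> (if even m then 0 else 1)) m = q (m div 2)"
      using pos[OF div2[OF m]] by (simp_all add: posterior[OF m] z_def w_def s_def)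
    have "\<pi> (if even m then 1 else 0) \<in> D" "\<pi> (if even m then 0 else 1) \<in> D"
      by (simp_all add: D_def)
    then have "p (m div 2) \<in> posterior_set p\<^sub>0 D m" "q (m div 2) \<in> posterior_set p\<^sub>0 D m"
      unfolding posterior_set_def ends[symmetric] by simp_all
    then show "closed_segment (p (m div 2)) (q (m div 2)) \<subseteq> posterior_set p\<^sub>0 D m"
      using belief_setsD(2)[OF P] by (intro closed_segment_subset)
  qed
  \<comment> \<open>The estimate below holds for every \<open>t\<close>, in particular for this one,
    which is worst for the sender.\<close>
  obtain t where t: "t \<in> {0..1}" "device_value A u\<^sub>S u\<^sub>R p\<^sub>0 M D = device_payoff p\<^sub>0 M D (\<pi> t)"
    using device_value_attained[OF p\<^sub>0(1) D finite] by (auto simp: D_def)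
  have "(\<Sum>i<k. fst (c i) \<bullet> (\<alpha> i *\<^sub>R p i + \<beta> i *\<^sub>R q i)) =
      (\<Sum>i<k. fst (c i) \<bullet> z t (2 * i) + fst (c i) \<bullet> z t (2 * i + 1))"
    by (simp only: z_pair inner_add_right[symmetric])
  also have "\<dots> = (\<Sum>m\<in>M. fst (c (m div 2)) \<bullet> z t m)"
    unfolding M_def sum_lessThan_double by simp
  also have "\<dots> \<le> (\<Sum>m\<in>M. msg_prob p\<^sub>0 (\<pi> t) m *
      sender_payoff (posterior_set p\<^sub>0 D m) (posterior p\<^sub>0 (\<pi> t) m))"
  proof (intro sum_mono)
    fix m assume m: "m \<in> M"
    note i = div2[OF m]
    have "fst (c (m div 2)) \<bullet> z t m = w t m * (fst (c (m div 2)) \<bullet> posterior p\<^sub>0 (\<pi> t) m)"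
      using w_pos[OF t(1) m] by (simp add: posterior[OF m])
    also have "\<dots> \<le> w t m * sender_payoff (posterior_set p\<^sub>0 D m) (posterior p\<^sub>0 (\<pi> t) m)"
      using w_pos[OF t(1) m] unfolding posterior_set[OF m]
      by (intro mult_left_mono sender_payoff_ge closed_segment_belief_sets p[OF i] q[OF i]
          supported_imp_best c[OF i]) simp
    finally show "fst (c (m div 2)) \<bullet> z t m \<le> msg_prob p\<^sub>0 (\<pi> t) m *
        sender_payoff (posterior_set p\<^sub>0 D m) (posterior p\<^sub>0 (\<pi> t) m)"
      by (simp add: msg_prob[OF m])
  qed
  also have "\<dots> = device_payoff p\<^sub>0 M D (\<pi> t)"
  proof -
    have "{m. m \<in> M \<and> 0 < msg_prob p\<^sub>0 (\<pi> t) m} = M"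
      using w_pos[OF t(1)] by (auto simp: msg_prob)
    then show ?thesis
      by (simp add: device_payoff_def)
  qed
  finally show ?thesis
    using D finite t(2) by (intro exI[of _ M] exI[of _ D]) simp
qed

text \<open>The outcome \<open>c\<close> pays the sender \<open>fst c \<bullet> p\<close> per unit of mass at \<open>p\<close>; the mass at the
  punishing belief \<open>q\<close> is positive but arbitrarily small, so that no closure is needed to realise
  a point of the convex hull by a device.\<close>

definition hedged :: "((real ^ 'w) \<times> real) set" where
  "hedged = {(\<alpha> *\<^sub>R p + \<beta> *\<^sub>R q, r) | \<alpha> \<beta> p q c r. 0 < \<alpha> \<and> 0 < \<beta> \<and> p \<in> beliefs \<and>
     supported p c q \<and> r \<le> fst c \<bullet> (\<alpha> *\<^sub>R p + \<beta> *\<^sub>R q)}"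

lemma hedgedI:
  "0 < \<alpha> \<Longrightarrow> 0 < \<beta> \<Longrightarrow> p \<in> beliefs \<Longrightarrow> supported p c q \<Longrightarrow>
    r \<le> fst c \<bullet> (\<alpha> *\<^sub>R p + \<beta> *\<^sub>R q) \<Longrightarrow> (\<alpha> *\<^sub>R p + \<beta> *\<^sub>R q, r) \<in> hedged"
  unfolding hedged_def by blast

lemma scaleR_hedged:
  assumes "x \<in> hedged" "0 < l"
  shows "l *\<^sub>R x \<in> hedged"
proof -
  obtain \<alpha> \<beta> p q c r where x: "x = (\<alpha> *\<^sub>R p + \<beta> *\<^sub>R q, r)" and pos: "0 < \<alpha>" "0 < \<beta>"
    and pc: "p \<in> beliefs" "supported p c q" and r: "r \<le> fst c \<bullet> (\<alpha> *\<^sub>R p + \<beta> *\<^sub>R q)"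
    using assms(1) unfolding hedged_def by blast
  have "l * r \<le> l * (fst c \<bullet> (\<alpha> *\<^sub>R p + \<beta> *\<^sub>R q))"
    using r assms(2) by (intro mult_left_mono) auto
  also have "\<dots> = fst c \<bullet> ((l * \<alpha>) *\<^sub>R p + (l * \<beta>) *\<^sub>R q)"
    by (simp add: inner_add_right algebra_simps)
  finally have "((l * \<alpha>) *\<^sub>R p + (l * \<beta>) *\<^sub>R q, l * r) \<in> hedged"
    using pos pc assms(2) by (intro hedgedI) auto
  then show ?thesis
    by (simp add: x scaleR_add_right)
qed

lemma ex_device_of_hedged:
  assumes p\<^sub>0: "p\<^sub>0 \<in> beliefs" "\<And>\<omega>. 0 < p\<^sub>0 $ \<omega>" and r: "(p\<^sub>0, r) \<in> convex hull hedged"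
  shows "\<exists>M D. finite M \<and> ambiguous_device p\<^sub>0 M D \<and> r \<le> device_value A u\<^sub>S u\<^sub>R p\<^sub>0 M D"
proof -
  obtain S u where S: "finite S" "S \<subseteq> hedged" "\<forall>x\<in>S. 0 \<le> u x" "(\<Sum>x\<in>S. u x *\<^sub>R x) = (p\<^sub>0, r)"
    using r unfolding convex_hull_explicit by blast
  \<comment> \<open>Zero weights are dropped first: only positive multiples stay in
    \<open>hedged\<close>, whose masses are strictly positive. The remaining weights are absorbed
    into \<alpha> and \<beta>.\<close>
  define T where "T = {x \<in> S. 0 < u x}"
  have "finite T"
    using S(1) by (simp add: T_def)
  then obtain h where h: "bij_betw h {..<card T} T"
    using ex_bij_betw_nat_finite by (metis atLeast0LessThan)
  define k where "k = card T"
  have "(\<Sum>x\<in>T. u x *\<^sub>R x) = (\<Sum>x\<in>S. u x *\<^sub>R x)"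
    using S(1,3) by (intro sum.mono_neutral_left) (auto simp: T_def order_less_le)
  then have sum_h: "(\<Sum>i<k. u (h i) *\<^sub>R h i) = (p\<^sub>0, r)"
    unfolding S(4) k_def using sum.reindex_bij_betw[OF h, of "\<lambda>x. u x *\<^sub>R x"] by simp
  have "u (h i) *\<^sub>R h i \<in> hedged" if "i < k" for i
  proof -
    have "h i \<in> T"
      using h that by (auto simp: k_def bij_betw_def)
    then show ?thesis
      using S(2) by (intro scaleR_hedged) (auto simp: T_def)
  qed
  then have "\<forall>i\<in>{..<k}. \<exists>\<alpha> \<beta> p q c r'. u (h i) *\<^sub>R h i = (\<alpha> *\<^sub>R p + \<beta> *\<^sub>R q, r') \<and> 0 < \<alpha> \<and> 0 < \<beta> \<and>
      p \<in> beliefs \<and> supported p c q \<and> r' \<le> fst c \<bullet> (\<alpha> *\<^sub>R p + \<beta> *\<^sub>R q)"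
    unfolding hedged_def by blast
  then obtain \<alpha> \<beta> p q c r' where
    *: "\<forall>i\<in>{..<k}. u (h i) *\<^sub>R h i = (\<alpha> i *\<^sub>R p i + \<beta> i *\<^sub>R q i, r' i) \<and> 0 < \<alpha> i \<and> 0 < \<beta> i \<and>
      p i \<in> beliefs \<and> supported (p i) (c i) (q i) \<and> r' i \<le> fst (c i) \<bullet> (\<alpha> i *\<^sub>R p i + \<beta> i *\<^sub>R q i)"
    unfolding bchoice_iff by blast
  have "(\<Sum>i<k. (\<alpha> i *\<^sub>R p i + \<beta> i *\<^sub>R q i, r' i)) = (p\<^sub>0, r)"
    using sum_h * by (metis (no_types, lifting) sum.cong)
  then have "(\<Sum>i<k. \<alpha> i *\<^sub>R p i + \<beta> i *\<^sub>R q i) = p\<^sub>0" and r': "(\<Sum>i<k. r' i) = r"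
    by (simp_all add: prod_eq_iff fst_sum snd_sum)
  then obtain M D where "finite M" "ambiguous_device p\<^sub>0 M D"
    "(\<Sum>i<k. fst (c i) \<bullet> (\<alpha> i *\<^sub>R p i + \<beta> i *\<^sub>R q i)) \<le> device_value A u\<^sub>S u\<^sub>R p\<^sub>0 M D"
    using ex_hedged_device[OF p\<^sub>0, of k p c q \<alpha> \<beta>] * by (auto simp only: lessThan_iff)
  moreover have "r \<le> (\<Sum>i<k. fst (c i) \<bullet> (\<alpha> i *\<^sub>R p i + \<beta> i *\<^sub>R q i))"
    unfolding r'[symmetric] using * by (intro sum_mono) blast
  ultimately show ?thesis
    by (meson order_trans)
qed

section \<open>Affine majorants by separation from the cone\<close>

lemma ex_affine_majorant:
  assumes p\<^sub>0: "p\<^sub>0 \<in> beliefs" "\<And>\<omega>. 0 < p\<^sub>0 $ \<omega>" and r: "(p\<^sub>0, r) \<notin> convex hull hedged"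
  shows "\<exists>H. (\<forall>q\<in>beliefs. sender_value A u\<^sub>S u\<^sub>R q \<le> H q) \<and> affine_on_beliefs H \<and>
    continuous_on beliefs H \<and> H p\<^sub>0 \<le> r"
proof -
  obtain c\<^sub>0 where c\<^sub>0: "supported p\<^sub>0 c\<^sub>0 p\<^sub>0"
    using ex_supported[OF p\<^sub>0(1)] by (elim exE)
  \<comment> \<open>A reference point of the cone, from the trivial pair with both beliefs equal to
    \<open>p\<^sub>0\<close> and both masses 1. Its second coordinate may be lowered at
    will.\<close>
  define y where "y = 1 *\<^sub>R p\<^sub>0 + 1 *\<^sub>R p\<^sub>0"
  have y: "(y, fst c\<^sub>0 \<bullet> y - n) \<in> hedged" if "0 \<le> n" for n
    unfolding y_def using that by (intro hedgedI[OF _ _ p\<^sub>0(1) c\<^sub>0]) auto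
  have "hedged \<noteq> {}"
    using y[of 0] by auto
  then have "convex hull hedged \<noteq> {}"
    by simp
  then have "\<exists>ab e. ab \<noteq> 0 \<and> (\<forall>x\<in>convex hull hedged. ab \<bullet> x \<le> e) \<and> (\<forall>x\<in>{(p\<^sub>0, r)}. e \<le> ab \<bullet> x)"
    using r by (intro separating_hyperplane_sets) auto
  then obtain ab e where ab: "ab \<noteq> 0" "\<And>x. x \<in> convex hull hedged \<Longrightarrow> ab \<bullet> x \<le> e" "e \<le> ab \<bullet> (p\<^sub>0, r)"
    by blast
  define a b where "a = fst ab" and "b = snd ab"
  have scaled: "l * (ab \<bullet> x) \<le> e" if "x \<in> hedged" "0 < l" for x l
    using ab(2)[of "l *\<^sub>R x"] scaleR_hedged[OF that] by (simp add: hull_inc)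
  have nonpos: "ab \<bullet> x \<le> 0" if x: "x \<in> hedged" for x
  proof (rule ccontr)
    assume *: "\<not> ab \<bullet> x \<le> 0"
    \<comment> \<open>A positive value of the functional could be scaled up to
      \<open>\<bar>e\<bar> + 1\<close>, beyond the bound \<open>e\<close>.\<close>
    have "(\<bar>e\<bar> + 1) / (ab \<bullet> x) * (ab \<bullet> x) \<le> e"
      using * by (intro scaled x) simp
    then show False
      using * by simp
  qed
  have e: "0 \<le> e"
  proof (rule ccontr)
    assume e: "\<not> 0 \<le> e"
    define g where "g = ab \<bullet> (y, fst c\<^sub>0 \<bullet> y)"
    have "g < 0"
      using scaled[OF y[of 0], of 1] e by (simp add: g_def)
    \<comment> \<open>This multiple of the reference point has value \<open>e / 2\<close>, above a
      negative bound \<open>e\<close>.\<close>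
    have "e / (2 * g) * g \<le> e"
      using scaled[OF y[of 0], of "e / (2 * g)"] e \<open>g < 0\<close> by (simp add: g_def divide_neg_neg)
    then show False
      using e \<open>g < 0\<close> by simp
  qed
  have b: "0 \<le> b"
  proof (rule ccontr)
    assume b: "\<not> 0 \<le> b"
    define g where "g = a \<bullet> y + b * (fst c\<^sub>0 \<bullet> y)"
    \<comment> \<open>Lowering the payoff by \<open>n\<close> would add
      \<open>\<bar>g\<bar> + 1\<close> to the functional and make it positive.\<close>
    define n where "n = (\<bar>g\<bar> + 1) / - b"
    have "0 \<le> n"
      unfolding n_def using b by (intro divide_nonneg_nonneg) auto
    from nonpos[OF y[OF this]] have "g - b * n \<le> 0"
      by (simp add: g_def a_def b_def inner_prod_def algebra_simps)
    moreover have "b * n = - (\<bar>g\<bar> + 1)"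
      using b by (simp add: n_def)
    ultimately show False
      by simp
  qed
  have le: "a \<bullet> p + b * (fst c \<bullet> p) \<le> 0" if p: "p \<in> beliefs" and c: "supported p c q" for p c q
  proof (rule ccontr)
    define X Y where "X = a \<bullet> p + b * (fst c \<bullet> p)" and "Y = a \<bullet> q + b * (fst c \<bullet> q)"
    assume "\<not> a \<bullet> p + b * (fst c \<bullet> p) \<le> 0"
    then have X: "0 < X"
      by (simp add: X_def)
    \<comment> \<open>So small a mass at \<open>q\<close> that its contribution, at least
      \<open>- (\<beta> * \<bar>Y\<bar>)\<close>, cannot cancel \<open>X\<close>. This removes the
      punishing belief from the inequality.\<close>
    define \<beta> where "\<beta> = X / (\<bar>Y\<bar> + 1)"
    have "0 < \<bar>Y\<bar> + 1"
      by simp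
    then have \<beta>: "0 < \<beta>" "\<beta> * (\<bar>Y\<bar> + 1) = X"
      using X by (simp_all only: \<beta>_def divide_pos_pos nonzero_divide_eq_eq[symmetric]) simp
    have "(1 *\<^sub>R p + \<beta> *\<^sub>R q, fst c \<bullet> (1 *\<^sub>R p + \<beta> *\<^sub>R q)) \<in> hedged"
      using \<beta>(1) p c by (intro hedgedI) auto
    from nonpos[OF this] have "X + \<beta> * Y \<le> 0"
      by (simp add: X_def Y_def a_def b_def inner_prod_def inner_add_right algebra_simps)
    moreover have "- (\<beta> * \<bar>Y\<bar>) \<le> \<beta> * Y"
      using \<beta>(1) by (simp add: abs_if mult_le_0_iff zero_le_mult_iff)
    ultimately show False
      using \<beta> by (simp add: distrib_left)
  qed
  have p\<^sub>0_ge: "0 \<le> a \<bullet> p\<^sub>0 + b * r"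
    using e ab(3) by (simp add: a_def b_def inner_prod_def)
  \<comment> \<open>If the hyperplane were vertical, the degenerate beliefs would force
    \<open>a \<le> 0\<close> in each coordinate; together with
    \<open>a \<bullet> p\<^sub>0 \<ge> 0\<close> and the full support of \<open>p\<^sub>0\<close>
    this gives \<open>a = 0\<close>.\<close>
  have "b \<noteq> 0"
  proof
    assume b0: "b = 0"
    have a: "a $ \<omega> \<le> 0" for \<omega>
    proof -
      have ax: "axis \<omega> 1 \<in> beliefs"
        by (auto simp: beliefs_def axis_def)
      obtain c where "supported (axis \<omega> 1) c (axis \<omega> 1)"
        using ex_supported[OF ax] by (elim exE)
      from le[OF ax this] show ?thesis
        by (simp add: b0 inner_axis)
    qed
    have "(\<Sum>\<omega>\<in>UNIV. - (a $ \<omega> * p\<^sub>0 $ \<omega>)) \<le> 0"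
      using p\<^sub>0_ge by (simp add: b0 inner_vec_def sum_negf)
    moreover have *: "0 \<le> - (a $ \<omega> * p\<^sub>0 $ \<omega>)" for \<omega>
      using a[of \<omega>] p\<^sub>0(2)[of \<omega>] by (simp add: mult_nonpos_nonneg)
    ultimately have "(\<Sum>\<omega>\<in>UNIV. - (a $ \<omega> * p\<^sub>0 $ \<omega>)) = 0"
      by (intro antisym sum_nonneg) auto
    then have "- (a $ \<omega> * p\<^sub>0 $ \<omega>) = 0" for \<omega>
      using * by (subst (asm) sum_nonneg_eq_0_iff) auto
    then have "a = 0"
      using p\<^sub>0(2) by (simp add: vec_eq_iff) (metis less_irrefl)
    then show False
      using ab(1) b0 by (simp add: a_def b_def prod_eq_iff)
  qed
  with b have b: "0 < b"
    by simp
  \<comment> \<open>The hyperplane \<open>a \<bullet> p + b * x = 0\<close>, moved to the origin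
    since \<open>e \<ge> 0\<close>, solved for the payoff \<open>x\<close>.\<close>
  define H where "H = (\<lambda>p. - (a \<bullet> p) / b)"
  have "sender_value A u\<^sub>S u\<^sub>R p \<le> H p" if p: "p \<in> beliefs" for p
  proof -
    obtain c q where c: "supported p c q" "sender_value A u\<^sub>S u\<^sub>R p = fst c \<bullet> p"
      using sender_value_attained[OF p] by (elim exE conjE)
    show ?thesis
      using le[OF p c(1)] b by (simp add: c(2) H_def field_simps)
  qed
  moreover have "affine_on_beliefs H"
    unfolding affine_on_beliefs_def H_def inner_add_right inner_scaleR_right
    using b by (simp add: field_simps)
  moreover have "continuous_on beliefs H"
    unfolding H_def using b by (intro continuous_intros) simp
  moreover have "H p\<^sub>0 \<le> r"
    using p\<^sub>0_ge b by (simp add: H_def field_simps)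
  ultimately show ?thesis
    by blast
qed

end

section \<open>Duality between devices and affine majorants\<close>

theorem theorem2p1:
  fixes A :: "'a::topological_space set"
    and u\<^sub>S u\<^sub>R :: "'a \<Rightarrow> 'w::finite \<Rightarrow> real"
    and p\<^sub>0 :: "real ^ 'w"
  assumes "p\<^sub>0 \<in> beliefs" and "\<And>\<omega>. p\<^sub>0 $ \<omega> > 0"
    and "compact A" and "A \<noteq> {}"
    and "\<And>\<omega>. continuous_on A (\<lambda>a. u\<^sub>S a \<omega>)"
    and "\<And>\<omega>. continuous_on A (\<lambda>a. u\<^sub>R a \<omega>)"
  shows "optimal_value A u\<^sub>S u\<^sub>R p\<^sub>0 = concave_closure (sender_value A u\<^sub>S u\<^sub>R) p\<^sub>0"
proof -
  interpret persuasion A u\<^sub>S u\<^sub>R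
    using assms by unfold_locales
  note p\<^sub>0 = assms(1,2)
  define V where "V = {device_value A u\<^sub>S u\<^sub>R p\<^sub>0 M D | M D. finite M \<and> ambiguous_device p\<^sub>0 M D}"
  define L where "L = {H p\<^sub>0 | H. (\<forall>q\<in>beliefs. sender_value A u\<^sub>S u\<^sub>R q \<le> H q) \<and>
    affine_on_beliefs H \<and> continuous_on beliefs H}"
  have le: "x \<le> l" if "x \<in> V" "l \<in> L" for x l
    using that device_value_le_affine[OF p\<^sub>0(1)] unfolding V_def L_def by blast
  \<comment> \<open>The strong half of the duality, valid at every level \<open>r\<close>:
    membership in the hull gives a device, non-membership a majorant.\<close>
  have dichotomy: "(\<exists>x\<in>V. r \<le> x) \<or> (\<exists>l\<in>L. l \<le> r)" for r
  proof (cases "(p\<^sub>0, r) \<in> convex hull hedged")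
    case True
    from ex_device_of_hedged[OF p\<^sub>0 this] show ?thesis
      unfolding V_def by blast
  next
    case False
    from ex_affine_majorant[OF p\<^sub>0 this] show ?thesis
      unfolding L_def by blast
  qed
  have V: "V \<noteq> {}"
  proof
    assume "V = {}"
    \<comment> \<open>Without devices some majorant would fall below the sender's value at the
      prior, tested at a level 1 lower.\<close>
    then obtain l where "l \<in> L" "l \<le> sender_value A u\<^sub>S u\<^sub>R p\<^sub>0 - 1"
      using dichotomy by blast
    then show False
      using p\<^sub>0(1) by (force simp: L_def)
  qed
  have "L \<noteq> {}"
  proof -
    obtain B where "\<And>p. p \<in> beliefs \<Longrightarrow> sender_value A u\<^sub>S u\<^sub>R p \<le> B"
      using sender_value_bounded by blast
    then have "(\<lambda>_. B) p\<^sub>0 \<in> L"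
      unfolding L_def by (intro CollectI exI[of _ "\<lambda>_. B"])
        (auto simp: affine_on_beliefs_def algebra_simps)
    then show ?thesis
      by auto
  qed
  have "Sup V = Inf L"
  proof (rule antisym)
    show "Sup V \<le> Inf L"
      using V \<open>L \<noteq> {}\<close> le by (intro cSup_least cInf_greatest)
    show "Inf L \<le> Sup V"
    proof (rule field_le_epsilon)
      fix \<epsilon> :: real assume "0 < \<epsilon>"
      have bdd: "bdd_above V" "bdd_below L"
        using V \<open>L \<noteq> {}\<close> le unfolding bdd_above_def bdd_below_def by blast+
      \<comment> \<open>No device reaches this level, so the dichotomy must yield a majorant below
        it.\<close>
      then have "\<not> (\<exists>x\<in>V. Sup V + \<epsilon> \<le> x)"
        using cSup_upper[OF _ bdd(1)] \<open>0 < \<epsilon>\<close> by fastforce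
      then obtain l where "l \<in> L" "l \<le> Sup V + \<epsilon>"
        using dichotomy by blast
      then show "Inf L \<le> Sup V + \<epsilon>"
        using cInf_lower[OF _ bdd(2)] order_trans by blast
    qed
  qed
  then show ?thesis
    unfolding optimal_value_def concave_closure_def V_def L_def .
qed

end
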